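(* Let $N\in\mathbb{N}$ be square-free and let $k>1$ be an integer. Let $f(z)\in M_{2k}(\Gamma_0(N))$. Then there exists a cusp form $C_N(f;z)\in S_{2k}(\Gamma_0(N))$ such that $$f(z)=\sum_{d\mid N}\left(\sum_{c\mid N}\frac{(-1)^{\omega(d)+\omega(c)}}{\prod_{p\mid N}(p^{2k}-1)}\left(\frac{N\gcd(c,d)}{c}\right)^{2k}[0]_cf(z)\right)E_{2k}(dz)+C_N(f;z).$$ In particular, if $f(z)\in E_{2k}(\Gamma_0(N))$, then $$f(z)=\sum_{d\mid N}\left(\sum_{c\mid N}\frac{(-1)^{\omega(d)+\omega(c)}}{\prod_{p\mid N}(p^{2k}-1)}\left(\frac{N\gcd(c,d)}{c}\right)^{2k}[0]_cf(z)\right)E_{2k}(dz).$$ Consequently, for every integer $n>0$, $$[n]f(z)=\frac{-4k}{B_{2k}}\sum_{d\mid N}\left(\sum_{c\mid N}\frac{(-1)^{\omega(d)+\omega(c)}}{\prod_{p\mid N}(p^{2k}-1)}\left(\frac{N\gcd(c,d)}{c}\right)^{2k}[0]_cf(z)\right)\sigma_{2k-1}(n/d)+[n]C_N(f;z),$$ and in particular, if $f(z)\in E_{2k}(\Gamma_0(N))$, then for every integer $n>0$, $$[n]f(z)=\frac{-4k}{B_{2k}}\sum_{d\mid N}\left(\sum_{c\mid N}\frac{(-1)^{\omega(d)+\omega(c)}}{\prod_{p\mid N}(p^{2k}-1)}\left(\frac{N\gcd(c,d)}{c}\right)^{2k}[0]_cf(z)\right)\sigma_{2k-1}(n/d).$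$
   Context: Throughout, $z$ lies in the upper half plane, $q=e^{2\pi i z}$, $p$ denotes primes, and all divisors are positive. $M_w(\Gamma_0(N))$ is the space of modular forms of weight $w$ for $\Gamma_0(N)$, and $E_w(\Gamma_0(N))$, $S_w(\Gamma_0(N))$ are its subspaces of Eisenstein forms and cusp forms, so that $M_w(\Gamma_0(N))=E_w(\Gamma_0(N))\oplus S_w(\Gamma_0(N))$. For $N$ square-free and $k>1$, $E_{2k}(\Gamma_0(N))$ is spanned by the functions $E_{2k}(dz)$, $d\mid N$. Here $$E_{2k}(z)=1-\frac{4k}{B_{2k}}\sum_{n\ge1}\sigma_{2k-1}(n)q^n,$$ where the Bernoulli numbers $B_n$ are defined by $\frac{x}{e^x-1}=\sum_{n\ge0}B_nx^n/n!$, and $\sigma_j(n)=\sum_{1\le d\mid n}d^j$ for $n\in\mathbb{N}$, with $\sigma_j(n)=0$ if $n\notin\mathbb{N}$. $\omega(d)$ is the number of distinct prime divisors of $d$. For $N$ square-free, $\{1/c: c\mid N\}$ is a set of representatives of the cusps of $\Gamma_0(N)$. For $f\in M_w(\Gamma_0(N))$ and $c\mid N$, write $A_c=\begin{bmatrix}-1&0\\c&-1\end{bmatrix}$, so $A_c^{-1}z=\frac{z}{cz+1}$, and $$f(A_c^{-1}z)=(cz+1)^w\sum_{n\ge0}a_c(n)e^{2\pi i nz/h},$$ where $h=N/c$ is the width of $\Gamma_0(N)$ at the cusp $1/c$; then $[n]_cf(z):=a_c(n)$. In particular $[0]_cf(z)$ is the constant term at the cusp $1/c$. $[n]f(z)$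 denotes the coefficient of $q^n$ in the Fourier expansion of $f$ at $\infty$. *)

theory Defs
  imports "HOL-Complex_Analysis.Complex_Analysis" "HOL-Computational_Algebra.Computational_Algebra"
begin

text \<open>
  Forms are total functions \<^typ>\<open>complex \<Rightarrow> complex\<close>; only their values on the upper half plane
  matter, and every notion below depends on those values only. A matrix with rows
  \<open>(a, b)\<close> and \<open>(c, d)\<close> is written \<open>(a, b, c, d)\<close>.
\<close>

definition upper_half_plane :: "complex set" where
  "upper_half_plane = {z. Im z > 0}"

definition SL2Z :: "(int \<times> int \<times> int \<times> int) set" where
  "SL2Z = {(a, b, c, d). a * d - b * c = 1}"

definition Gamma0 :: "nat \<Rightarrow> (int \<times> int \<times> int \<times> int) set" where
  "Gamma0 N = {(a, b, c, d). (a, b, c, d) \<in> SL2Z \<and> int N dvd c}"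

definition slash ::
    "nat \<Rightarrow> (complex \<Rightarrow> complex) \<Rightarrow> int \<times> int \<times> int \<times> int \<Rightarrow> complex \<Rightarrow> complex" where
  "slash w f = (\<lambda>(a, b, c, d) z.
     f ((of_int a * z + of_int b) / (of_int c * z + of_int d)) / (of_int c * z + of_int d) ^ w)"


subsection \<open>Fourier expansions\<close>

definition has_fourier_expansion ::
    "real \<Rightarrow> (complex \<Rightarrow> complex) \<Rightarrow> (nat \<Rightarrow> complex) \<Rightarrow> bool" where
  "has_fourier_expansion h g a \<longleftrightarrow>
     (\<forall>z\<in>upper_half_plane.
        (\<lambda>n. a n * exp (2 * of_real pi * \<i> * of_nat n * z / of_real h)) sums g z)"

text \<open>For \<open>h > 0\<close> there is at most one such expansion; the value is only meaningful if it exists.\<close>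

definition fourier_coeff :: "real \<Rightarrow> (complex \<Rightarrow> complex) \<Rightarrow> nat \<Rightarrow> complex" where
  "fourier_coeff h g = (THE a. has_fourier_expansion h g a)"

text \<open>The coefficient of \<open>q\<^sup>n\<close> at infinity.\<close>

definition coeff_at_infinity :: "nat \<Rightarrow> (complex \<Rightarrow> complex) \<Rightarrow> complex" where
  "coeff_at_infinity n f = fourier_coeff 1 f n"

text \<open>
  The \<open>n\<close>-th coefficient at the cusp \<open>1/c\<close>, for \<open>N\<close> square-free and \<open>c\<close> a divisor of \<open>N\<close>. The matrix
  \<open>(1, 0, c, 1)\<close> acts as the inverse of \<open>A_c = (-1, 0, c, -1)\<close>, that is, by \<open>z \<mapsto> z / (c z + 1)\<close>,
  and \<open>N / c\<close> is the width of the cusp.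
\<close>

definition coeff_at_cusp ::
    "nat \<Rightarrow> nat \<Rightarrow> nat \<Rightarrow> nat \<Rightarrow> (complex \<Rightarrow> complex) \<Rightarrow> complex" where
  "coeff_at_cusp N w c n f =
     fourier_coeff (real N / real c) (\<lambda>z. f (z / (of_nat c * z + 1)) / (of_nat c * z + 1) ^ w) n"


subsection \<open>Modular forms, cusp forms and Eisenstein forms\<close>

text \<open>
  Every conjugate of \<open>Gamma0 N\<close> in \<open>SL2Z\<close> contains \<open>(1, N, 0, 1)\<close>, so the period \<open>N\<close> can be used for
  the expansions at all cusps.
\<close>

definition modular_forms :: "nat \<Rightarrow> nat \<Rightarrow> (complex \<Rightarrow> complex) set" where
  "modular_forms w N = {f. f holomorphic_on upper_half_plane
     \<and> (\<forall>A\<in>Gamma0 N. \<forall>z\<in>upper_half_plane. slash w f A z = f z)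
     \<and> (\<forall>A\<in>SL2Z. \<exists>a. has_fourier_expansion (real N) (slash w f A) a)}"

definition cusp_forms :: "nat \<Rightarrow> nat \<Rightarrow> (complex \<Rightarrow> complex) set" where
  "cusp_forms w N = {f \<in> modular_forms w N.
     \<forall>A\<in>SL2Z. \<exists>a. has_fourier_expansion (real N) (slash w f A) a \<and> a 0 = 0}"

text \<open>
  The Eisenstein series of weight \<open>w > 2\<close> attached to the cusp \<open>a/c\<close> in lowest terms (\<open>1/0\<close> is
  infinity): the sum of \<open>(m z + n)\<close> to the power \<open>-w\<close> over the orbit of the row vector \<open>(-c, a)\<close>
  under right multiplication by \<open>Gamma0 N\<close>. If \<open>\<sigma>\<close> in \<open>SL2Z\<close> maps infinity to \<open>a/c\<close>, then \<open>(-c, a)\<close>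
  is the bottom row of the inverse of \<open>\<sigma>\<close>, so for even \<open>w\<close> this is twice the usual sum of
  \<open>j(\<sigma>\<^sup>-\<^sup>1 \<gamma>, z)\<close> to the power \<open>-w\<close> over the cosets of the stabiliser of the cusp in \<open>Gamma0 N\<close>
  (both signs of each row occur).
\<close>

definition cusp_eisenstein_series :: "nat \<Rightarrow> nat \<Rightarrow> int \<times> int \<Rightarrow> complex \<Rightarrow> complex" where
  "cusp_eisenstein_series w N = (\<lambda>(a, c) z.
     \<Sum>\<^sub>\<infinity>(m, n) \<in> {(a * r - c * p, a * s - c * q) | p q r s. (p, q, r, s) \<in> Gamma0 N}.
       1 / (of_int m * z + of_int n) ^ w)"

text \<open>
  For \<open>w > 2\<close>, the subspace of Eisenstein forms: the forms that agree on the upper half plane with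
  a linear combination of the Eisenstein series attached to the cusps.
\<close>

definition eisenstein_forms :: "nat \<Rightarrow> nat \<Rightarrow> (complex \<Rightarrow> complex) set" where
  "eisenstein_forms w N = {f \<in> modular_forms w N.
     \<exists>S u. finite S \<and> (\<forall>(a, c)\<in>S. coprime a c) \<and>
       (\<forall>z\<in>upper_half_plane. f z = (\<Sum>s\<in>S. u s * cusp_eisenstein_series w N s z))}"


subsection \<open>The series \<open>E_2k\<close>\<close>

definition bernoulli_number :: "nat \<Rightarrow> real" where
  "bernoulli_number n = fact n * fps_nth (fps_X / (fps_exp 1 - 1)) n"

text \<open>The argument is rational so that the value is 0 off the positive integers.\<close>

definition divisor_sigma :: "nat \<Rightarrow> rat \<Rightarrow> nat" where
  "divisor_sigma j x = (if \<exists>n>0. x = of_nat n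
                then \<Sum>d | d dvd (THE n. x = of_nat n). d ^ j else 0)"

definition eisenstein_E :: "nat \<Rightarrow> complex \<Rightarrow> complex" where
  "eisenstein_E k z = 1 - of_nat (4 * k) / of_real (bernoulli_number (2 * k)) *
     (\<Sum>n. of_nat (divisor_sigma (2 * k - 1) (of_nat (Suc n))) * exp (2 * of_real pi * \<i> * z) ^ Suc n)"

definition omega :: "nat \<Rightarrow> nat" where
  "omega d = card (prime_factors d)"

text \<open>The coefficient of \<open>E_2k(d z)\<close> in the decomposition of \<open>f\<close>.\<close>

definition eisenstein_part_coeff :: "nat \<Rightarrow> nat \<Rightarrow> (complex \<Rightarrow> complex) \<Rightarrow> nat \<Rightarrow> complex" where
  "eisenstein_part_coeff N k f d =
     (\<Sum>c | c dvd N. (- 1) ^ (omega d + omega c) / (\<Prod>p\<in>prime_factors N. of_nat p ^ (2 * k) - 1)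
        * (of_nat (N * gcd c d) / of_nat c) ^ (2 * k) * coeff_at_cusp N (2 * k) c 0 f)"

end

theory Submission
  imports Defs
begin

text \<open>
  Two matrices indexed by the divisors of \<open>N\<close> govern the proof. The first one is
  \<open>M(d, c) = (gcd(d, c) / d)\<^sup>2\<^sup>k\<close>. It appears twice.

  It is the constant term of \<open>E(d z)\<close> at the cusp \<open>1/c\<close>. Indeed, if \<open>A\<close> has lower left entry \<open>c\<close>, then the
  matrix of \<open>z \<mapsto> d A z\<close> is an element of \<open>SL2Z\<close> times an upper triangular matrix with diagonal
  \<open>gcd(d, c), d / gcd(d, c)\<close>, and \<open>E\<close> is invariant under \<open>SL2Z\<close> (\<open>slash_eisenstein_E_scaled\<close>).

  It is also the transition matrix from the Eisenstein series attached to the cusps to the dilates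
  of \<open>E\<close>. For squarefree \<open>N\<close>, the orbit of a primitive row vector \<open>(m, n)\<close> under \<open>Gamma0 N\<close> is
  determined by \<open>gcd(m, N)\<close> (\<open>Gamma0_orbit_eq_primitive_pairs\<close>). Sorting the lattice sum for
  \<open>2 \<zeta>(2k) E(d z)\<close> by multiples of primitive vectors gives \<open>2 E(d z) = \<Sum>\<^sub>g M(d, g) P\<^sub>g(z)\<close>, where \<open>P\<^sub>g\<close> is the
  Eisenstein series of the orbit of \<open>g\<close> (\<open>lattice_sum_scaled_eq_primitive_sums\<close>).

  The second matrix consists of the weights
  \<open>X(c, d) = (-1)^(\<omega>(d) + \<omega>(c)) (N gcd(c, d) / c)\<^sup>2\<^sup>k / \<Prod>\<^sub>p (p\<^sup>2\<^sup>k - 1)\<close> of the theorem, and \<open>X M\<close> is the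
  identity. Both matrices are products of local ones over the primes \<open>p\<close> of \<open>N\<close>, so this
  reduces to \<open>2 \<times> 2\<close> matrices (\<open>cusp_weight_inverse\<close>).

  Hence the combination \<open>F\<close> of the \<open>E(d z)\<close> with coefficients \<open>\<Sum>\<^sub>c X(c, d) [0]\<^sub>c f\<close> has the same constant term
  as \<open>f\<close> at every cusp \<open>1/c\<close>. As these are all the cusps (\<open>SL2Z_cusp_representative\<close>), the difference
  \<open>f - F\<close> is a cusp form. If \<open>f\<close> is an Eisenstein form, say \<open>f = \<Sum>\<^sub>c u\<^sub>c P\<^sub>c\<close>, then
  \<open>P\<^sub>c = 2 \<Sum>\<^sub>d X(c, d) E(d z)\<close>, and taking constant terms gives \<open>[0]\<^sub>c f = 2 u\<^sub>c\<close>; so \<open>f = F\<close>.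

  The modularity of \<open>E\<close>, which is given by its \<open>q\<close>-expansion, comes from the lattice sum
  \<open>\<Sum> (m z + n)\<close> to the power \<open>-2k\<close>. Its Fourier series needs the Lipschitz formula and its
  normalisation needs Euler's formula for \<open>\<zeta>(2k)\<close>. Both follow from the reflection formula of the digamma
  function, \<open>\<psi>(1 - z) - \<psi>(z) = \<pi> cot(\<pi> z)\<close>: the first by differentiating its expansion in powers of
  \<open>q\<close>, the second by comparing Taylor coefficients at 0.
\<close>


section \<open>Fourier expansions on the upper half plane\<close>

text \<open>
  Every point of the punctured unit disc is \<open>exp (2 \<pi> i z / h)\<close> for some \<open>z\<close> in the upper half
  plane, so a Fourier expansion is the same thing as a power series on that disc.
\<close>
lemma q_parameter_surj:
  fixes x :: complex
  assumes "h > 0" "x \<noteq> 0" "norm x < 1"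
  obtains z where "z \<in> upper_half_plane" "\<And>n. x ^ n = exp (2 * of_real pi * \<i> * of_nat n * z / of_real h)"
proof
  define z where "z = of_real h * Ln x / (2 * of_real pi * \<i>)"
  show "x ^ n = exp (2 * of_real pi * \<i> * of_nat n * z / of_real h)" for n
  proof -
    have "2 * of_real pi * \<i> * of_nat n * z / of_real h = of_nat n * Ln x"
      using \<open>h > 0\<close> by (simp add: z_def field_simps)
    then show ?thesis using assms by (simp add: exp_of_nat_mult)
  qed
  have "z = of_real (h / (2 * pi)) * (- \<i> * Ln x)"
    using pi_gt_zero by (simp add: z_def field_simps)
  then have "Im z = h / (2 * pi) * (- Re (Ln x))"
    by (simp only: Im_complex_of_real Re_complex_of_real times_complex.sel) simp
  moreover have "Re (Ln x) < 0" using assms by simp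
  ultimately show "z \<in> upper_half_plane"
    using \<open>h > 0\<close> by (auto simp: upper_half_plane_def divide_neg_pos mult_pos_neg)
qed

text \<open>
  The difference of two expansions is a power series that vanishes on the punctured disc; a limit
  at 0 kills its constant term, and then the isolation of zeros kills the others.
\<close>
lemma has_fourier_expansion_unique:
  assumes "h > 0" "has_fourier_expansion h g a" "has_fourier_expansion h g b"
  shows "a = b"
proof -
  define c where "c n = a n - b n" for n
  have c: "(\<lambda>n. c n * x ^ n) sums 0" if x: "x \<noteq> 0" "norm x < 1" for x
  proof -
    obtain z where z: "z \<in> upper_half_plane" "\<And>n. x ^ n = exp (2 * of_real pi * \<i> * of_nat n * z / of_real h)"
      using q_parameter_surj[OF \<open>h > 0\<close> x] by blast
    then have "(\<lambda>n. a n * x ^ n) sums g z" "(\<lambda>n. b n * x ^ n) sums g z"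
      using assms(2,3) unfolding has_fourier_expansion_def z(2) by (blast intro: z(1))+
    from sums_diff[OF this] show ?thesis by (simp add: c_def algebra_simps)
  qed
  have c0: "c 0 = 0"
  proof -
    have "((\<lambda>x::complex. 0) \<longlongrightarrow> c 0) (at 0)"
      by (rule powser_limit_0_strong[of 1]) (use c in auto)
    then show ?thesis using tendsto_const_iff[of "at (0::complex)" 0 "c 0"] by simp
  qed
  have "c m = 0" for m
  proof (rule ccontr)
    assume m: "c m \<noteq> 0"
    have sums: "(\<lambda>n. c n * (x - 0) ^ n) sums 0" if "norm (x - 0) < 1" for x
      using c[of x] that powser_sums_zero[of c] by (cases "x = 0") (auto simp: c0)
    have "m > 0" using m c0 by (cases m) auto
    from powser_0_nonzero[of 1 0 c "\<lambda>_. 0" m, OF _ sums _ m this]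
    obtain s where s: "0 < s" "\<And>z::complex. z \<in> cball 0 s - {0} \<Longrightarrow> (0::complex) \<noteq> 0"
      by auto
    from s(2)[of "of_real s"] s(1) show False by simp
  qed
  then show ?thesis by (auto simp: c_def)
qed

lemma fourier_coeff_eq:
  assumes "h > 0" "has_fourier_expansion h g a"
  shows "fourier_coeff h g = a"
  unfolding fourier_coeff_def using assms has_fourier_expansion_unique by blast

lemma has_fourier_expansion_cong:
  assumes "\<And>z. z \<in> upper_half_plane \<Longrightarrow> f z = g z"
  shows "has_fourier_expansion h f a \<longleftrightarrow> has_fourier_expansion h g a"
  using assms by (simp add: has_fourier_expansion_def)

lemma fourier_coeff_cong:
  assumes "\<And>z. z \<in> upper_half_plane \<Longrightarrow> f z = g z"
  shows "fourier_coeff h f = fourier_coeff h g"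
  unfolding fourier_coeff_def using has_fourier_expansion_cong[of f g h] assms
  by (intro arg_cong[of _ _ The] ext) blast

lemma has_fourier_expansion_cmult:
  assumes "has_fourier_expansion h f a"
  shows "has_fourier_expansion h (\<lambda>z. u * f z) (\<lambda>n. u * a n)"
  using assms unfolding has_fourier_expansion_def by (auto simp: mult.assoc intro: sums_mult)

lemma has_fourier_expansion_sum:
  assumes "\<And>i. i \<in> I \<Longrightarrow> has_fourier_expansion h (f i) (a i)"
  shows "has_fourier_expansion h (\<lambda>z. \<Sum>i\<in>I. f i z) (\<lambda>n. \<Sum>i\<in>I. a i n)"
  using assms unfolding has_fourier_expansion_def by (auto simp: sum_distrib_right intro: sums_sum)

lemma has_fourier_expansion_translate:
  assumes "has_fourier_expansion h f a"
  shows "has_fourier_expansion h (\<lambda>z. f (z + of_real t))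
           (\<lambda>n. a n * exp (2 * of_real pi * \<i> * of_nat n * of_real t / of_real h))"
  unfolding has_fourier_expansion_def
proof
  fix z assume "z \<in> upper_half_plane"
  then have "z + of_real t \<in> upper_half_plane" by (simp add: upper_half_plane_def)
  with assms show "(\<lambda>n. a n * exp (2 * of_real pi * \<i> * of_nat n * of_real t / of_real h)
      * exp (2 * of_real pi * \<i> * of_nat n * z / of_real h)) sums f (z + of_real t)"
    unfolding has_fourier_expansion_def
    by (fastforce simp: ring_distribs add_divide_distrib exp_add mult_ac)
qed

text \<open>
  Translating by \<open>h\<close> multiplies the \<open>n\<close>-th coefficient by \<open>exp (2 \<pi> i n / m)\<close>. If the function is
  unchanged, uniqueness forces the coefficients off the multiples of \<open>m\<close> to vanish, and what
  remains is an expansion of the smaller period. This links the period \<open>N\<close>, common to all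
  expansions of a form, to the true width of each cusp.
\<close>
lemma has_fourier_expansion_coarsen:
  assumes "has_fourier_expansion (real (m * h)) g a" "m > 0" "h > 0"
    and "\<And>z. z \<in> upper_half_plane \<Longrightarrow> g (z + of_nat h) = g z"
  shows "has_fourier_expansion (real h) g (\<lambda>n. a (m * n))"
proof -
  let ?e = "\<lambda>n. exp (2 * of_real pi * \<i> * of_nat n * of_real (real h) / of_real (real (m * h)))"
  have "has_fourier_expansion (real (m * h)) g (\<lambda>n. a n * ?e n)"
    using has_fourier_expansion_translate[OF assms(1), of "real h"] assms(4)
    by (simp add: has_fourier_expansion_def)
  then have eq: "a n = a n * ?e n" for n
    using has_fourier_expansion_unique[OF _ assms(1), of "\<lambda>n. a n * ?e n"] assms
    by (metis mult_pos_pos of_nat_0_less_iff)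
  have zero: "a n = 0" if "\<not> m dvd n" for n
  proof -
    have "?e n \<noteq> 1"
    proof
      assume "?e n = 1"
      then obtain j :: int where
        "Im (2 * of_real pi * \<i> * of_nat n * of_real (real h) / of_real (real (m * h))) = of_int (2 * j) * pi"
        unfolding exp_eq_1 by blast
      moreover have "2 * of_real pi * \<i> * of_nat n * of_real (real h) / of_real (real (m * h))
          = \<i> * of_real (2 * pi * (real n / real m))"
        using \<open>h > 0\<close> \<open>m > 0\<close> by (simp add: field_simps)
      ultimately have "2 * pi * (real n / real m) = 2 * pi * of_int j" by simp
      then have "real n / real m = of_int j" using pi_gt_zero by (simp only: mult_cancel_left) simp
      then have "real_of_int (int n) = real_of_int (j * int m)" using \<open>m > 0\<close> by (simp add: field_simps)
      then have "int n = j * int m" unfolding of_int_eq_iff .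
      then show False using that by (metis dvd_triv_right of_nat_dvd_iff)
    qed
    with eq[of n] show ?thesis by simp
  qed
  have "strict_mono ((*) m)" using \<open>m > 0\<close> by (auto simp: strict_mono_def)
  note re = sums_mono_reindex[OF this]
  show ?thesis unfolding has_fourier_expansion_def
  proof
    fix z assume "z \<in> upper_half_plane"
    then have "(\<lambda>n. a n * exp (2 * of_real pi * \<i> * of_nat n * z / of_real (real (m * h)))) sums g z"
      using assms(1) by (simp add: has_fourier_expansion_def)
    then have "(\<lambda>n. a (m * n) * exp (2 * of_real pi * \<i> * of_nat (m * n) * z / of_real (real (m * h)))) sums g z"
      by (subst re) (auto intro!: zero simp: dvd_def image_iff)
    then show "(\<lambda>n. a (m * n) * exp (2 * of_real pi * \<i> * of_nat n * z / of_real (real h))) sums g z"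
      using \<open>m > 0\<close> by (simp add: field_simps)
  qed
qed

text \<open>
  With \<open>N = de * e\<close>, the exponential \<open>exp (2 \<pi> i n y)\<close> at \<open>y = (al z + be) / de\<close> is a constant times
  \<open>exp (2 \<pi> i (al e n) z / N)\<close>: the expansion is thinned out by the factor \<open>al e\<close>. The case
  \<open>de = 1\<close>, \<open>be = 0\<close> gives the expansion of a dilate \<open>g (al z)\<close>.
\<close>
lemma has_fourier_expansion_rescale:
  fixes al de :: nat and be :: int
  assumes "has_fourier_expansion 1 g a" "al > 0" "de > 0" "de dvd N" "N > 0"
  defines "s \<equiv> al * (N div de)"
  shows "has_fourier_expansion (real N) (\<lambda>z. g ((of_nat al * z + of_int be) / of_nat de))
    (\<lambda>n. if s dvd n then
        a (n div s) * exp (2 * of_real pi * \<i> * of_nat (n div s) * of_int be / of_nat de) else 0)"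
    (is "has_fourier_expansion _ _ ?b")
proof -
  obtain e where N: "N = de * e" using assms(4) by blast
  then have s: "s = al * e" using assms(3) by (simp add: s_def)
  have "s > 0" "e > 0" using assms(2-5) N by (auto simp: s intro!: Nat.gr0I)
  have "strict_mono ((*) s)" using \<open>s > 0\<close> by (auto simp: strict_mono_def)
  note re = sums_mono_reindex[OF this]
  show ?thesis
    unfolding has_fourier_expansion_def
  proof
    fix z assume "z \<in> upper_half_plane"
    define y where "y = (of_nat al * z + of_int be) / of_nat de"
    have "y = of_real (1 / real de) * (of_real (real al) * z + of_int be)" by (simp add: y_def)
    then have "Im y = 1 / real de * (real al * Im z)"
      by (simp only: Im_complex_of_real Re_complex_of_real times_complex.sel plus_complex.sel) simp
    then have "y \<in> upper_half_plane"
      using \<open>z \<in> _\<close> assms by (simp add: upper_half_plane_def)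
    then have "(\<lambda>n. a n * exp (2 * of_real pi * \<i> * of_nat n * y / of_real 1)) sums g y"
      using assms(1) unfolding has_fourier_expansion_def by blast
    also have "(\<lambda>n. a n * exp (2 * of_real pi * \<i> * of_nat n * y / of_real 1)) =
       (\<lambda>n. ?b (s * n) * exp (2 * of_real pi * \<i> * of_nat (s * n) * z / of_real (real N)))"
    proof
      fix n
      have "2 * of_real pi * \<i> * of_nat n * y / of_real 1 = 2 * of_real pi * \<i> * of_nat n * of_int be / of_nat de
         + 2 * of_real pi * \<i> * of_nat (s * n) * z / of_real (real N)"
        using \<open>e > 0\<close> \<open>de > 0\<close> by (simp add: y_def N s field_simps)
      then show "a n * exp (2 * of_real pi * \<i> * of_nat n * y / of_real 1) =
         ?b (s * n) * exp (2 * of_real pi * \<i> * of_nat (s * n) * z / of_real (real N))"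
        using \<open>s > 0\<close> by (simp only: exp_add) simp
    qed
    finally show "(\<lambda>n. ?b n * exp (2 * of_real pi * \<i> * of_nat n * z / of_real (real N))) sums g ((of_nat al * z + of_int be) / of_nat de)"
      unfolding y_def[symmetric] by (subst (asm) re) auto
  qed
qed

lemma has_fourier_expansion_imp_holomorphic:
  assumes "h > 0" "has_fourier_expansion h f a"
  shows "f holomorphic_on upper_half_plane"
proof -
  let ?q = "\<lambda>z::complex. exp (2 * of_real pi * \<i> * z / of_real h)"
  define F where "F x = (\<Sum>n. a n * x ^ n)" for x
  have F: "(\<lambda>n. a n * (x - 0) ^ n) sums F x" if x: "x \<in> ball 0 1" for x
  proof (cases "x = 0")
    case False
    with x have "norm x < 1" by simp
    then obtain z where z: "z \<in> upper_half_plane" "\<And>n. x ^ n = exp (2 * of_real pi * \<i> * of_nat n * z / of_real h)"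
      using q_parameter_surj[OF \<open>h > 0\<close> False] by blast
    then have "(\<lambda>n. a n * x ^ n) sums f z" using assms(2) by (simp add: has_fourier_expansion_def)
    then show ?thesis by (simp add: F_def sums_iff)
  qed (use powser_sums_zero[of a] in \<open>simp add: F_def\<close>)
  have "F holomorphic_on ball 0 1"
    by (rule power_series_holomorphic[OF F])
  moreover have "?q ` upper_half_plane \<subseteq> ball 0 1"
    using assms(1) by (auto simp: upper_half_plane_def norm_exp_eq_Re)
  ultimately have "(F \<circ> ?q) holomorphic_on upper_half_plane"
    by (intro holomorphic_on_compose_gen[of _ _ _ "ball 0 1"] holomorphic_intros) (use assms in auto)
  moreover have "(F \<circ> ?q) z = f z" if "z \<in> upper_half_plane" for z
  proof -
    have "?q z ^ n = exp (2 * of_real pi * \<i> * of_nat n * z / of_real h)" for n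
      by (simp add: mult_ac flip: exp_of_nat_mult)
    then show ?thesis using assms(2) that by (simp add: has_fourier_expansion_def F_def sums_iff)
  qed
  ultimately show ?thesis by (rule holomorphic_transform)
qed

section \<open>The slash action of SL2Z\<close>

definition mat_mul :: "int \<times> int \<times> int \<times> int \<Rightarrow> int \<times> int \<times> int \<times> int \<Rightarrow> int \<times> int \<times> int \<times> int" where
  "mat_mul = (\<lambda>(a, b, c, d) (a', b', c', d'). (a * a' + b * c', a * b' + b * d', c * a' + d * c', c * b' + d * d'))"

lemma mat_mul_SL2Z:
  assumes "A \<in> SL2Z" "B \<in> SL2Z"
  shows "mat_mul A B \<in> SL2Z"
proof -
  obtain a b c d a' b' c' d' where [simp]: "A = (a, b, c, d)" "B = (a', b', c', d')"
    by (metis prod_cases4)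
  have "(a * a' + b * c') * (c * b' + d * d') - (a * b' + b * d') * (c * a' + d * c')
      = (a * d - b * c) * (a' * d' - b' * c')" by algebra
  then show ?thesis using assms by (simp add: SL2Z_def mat_mul_def)
qed

lemma linear_factor_nonzero:
  assumes "z \<in> upper_half_plane" "(c, d) \<noteq> (0, 0)"
  shows "of_int c * z + of_int d \<noteq> 0"
proof
  assume eq: "of_int c * z + of_int d = 0"
  then have "Im (of_int c * z + of_int d) = 0" by simp
  then have "c = 0" using assms(1) by (simp add: upper_half_plane_def)
  with eq assms(2) show False by simp
qed

lemma SL2Z_denominator_nonzero:
  assumes "(a, b, c, d) \<in> SL2Z" "z \<in> upper_half_plane"
  shows "of_int c * z + of_int d \<noteq> 0"
  using assms by (intro linear_factor_nonzero) (auto simp: SL2Z_def)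

lemma moebius_upper_half_plane:
  assumes "(a, b, c, d) \<in> SL2Z" "z \<in> upper_half_plane"
  shows "(of_int a * z + of_int b) / (of_int c * z + of_int d) \<in> upper_half_plane"
proof -
  let ?w = "of_int c * z + of_int d"
  have w: "?w \<noteq> 0" using SL2Z_denominator_nonzero[OF assms] .
  have "Im ((of_int a * z + of_int b) * cnj ?w) = real_of_int (a * d - b * c) * Im z"
    by (simp add: algebra_simps)
  also have "\<dots> = Im z" using assms(1) by (simp add: SL2Z_def)
  finally have "Im ((of_int a * z + of_int b) * cnj ?w) > 0"
    using assms(2) by (simp add: upper_half_plane_def)
  moreover have "(of_int a * z + of_int b) / ?w = (of_int a * z + of_int b) * cnj ?w / of_real ((cmod ?w)\<^sup>2)"
    using complex_div_cnj by (metis of_real_power)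
  ultimately show ?thesis using w
    by (simp only: upper_half_plane_def mem_Collect_eq Im_divide_of_real) simp
qed

text \<open>
  The cocycle relation \<open>j(AB, z) = j(A, Bz) j(B, z)\<close> for the denominators.
\<close>
lemma slash_mat_mul:
  assumes "A \<in> SL2Z" "B \<in> SL2Z" "z \<in> upper_half_plane"
  shows "slash w f (mat_mul A B) z = slash w (slash w f A) B z"
proof -
  obtain a b c d a' b' c' d' where [simp]: "A = (a, b, c, d)" "B = (a', b', c', d')"
    by (metis prod_cases4)
  define u v where "u = of_int a' * z + of_int b'" and "v = of_int c' * z + of_int d'"
  have v: "v \<noteq> 0" using SL2Z_denominator_nonzero assms by (simp add: v_def)
  have "of_int c * (u / v) + of_int d \<noteq> 0"
    using SL2Z_denominator_nonzero[of a b c d "u / v"] moebius_upper_half_plane[of a' b' c' d' z] assms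
    by (simp add: u_def v_def)
  have num: "of_int (a * a' + b * c') * z + of_int (a * b' + b * d') = of_int a * u + of_int b * v"
    and den: "of_int (c * a' + d * c') * z + of_int (c * b' + d * d') = of_int c * u + of_int d * v"
    by (simp_all add: u_def v_def algebra_simps)
  have X: "of_int c * u + of_int d * v = (of_int c * (u / v) + of_int d) * v"
    "of_int a * u + of_int b * v = (of_int a * (u / v) + of_int b) * v"
    using v by (simp_all add: field_simps)
  have "slash w f (mat_mul A B) z = f ((of_int a * u + of_int b * v) / (of_int c * u + of_int d * v))
      / (of_int c * u + of_int d * v) ^ w"
    by (simp only: slash_def mat_mul_def split num den \<open>A = _\<close> \<open>B = _\<close>)
  also have "\<dots> = f ((of_int a * (u / v) + of_int b) / (of_int c * (u / v) + of_int d))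
      / (of_int c * (u / v) + of_int d) ^ w / v ^ w"
    unfolding X using v by (simp only: power_mult_distrib) simp
  also have "\<dots> = slash w (slash w f A) B z"
    by (simp only: slash_def split u_def v_def \<open>A = _\<close> \<open>B = _\<close>)
  finally show ?thesis .
qed

lemma slash_cong:
  assumes "A \<in> SL2Z" "z \<in> upper_half_plane" "\<And>z. z \<in> upper_half_plane \<Longrightarrow> f z = g z"
  shows "slash w f A z = slash w g A z"
  using assms moebius_upper_half_plane by (cases A) (auto simp: slash_def)

lemma slash_sum_scaled: "slash w (\<lambda>z. \<Sum>i\<in>I. u i * f i z) A z = (\<Sum>i\<in>I. u i * slash w (f i) A z)"
  by (cases A) (simp add: slash_def sum_divide_distrib)

lemma Gamma0_subset_SL2Z: "Gamma0 N \<subseteq> SL2Z"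
  by (auto simp: Gamma0_def)

section \<open>The digamma function, polygamma reflection and even zeta values\<close>

text \<open>
  This is the logarithmic derivative of Euler's reflection formula
  \<open>\<Gamma>(z) \<Gamma>(1 - z) sin(\<pi> z) = \<pi>\<close>, with the denominator \<open>sin(\<pi> z)\<close> cleared.
\<close>
lemma Digamma_reflection:
  fixes z :: complex
  assumes "z \<notin> \<int>"
  shows "(Digamma (1 - z) - Digamma z) * sin (of_real pi * z) = of_real pi * cos (of_real pi * z)"
proof -
  let ?f = "\<lambda>z::complex. Gamma z * Gamma (1 - z) * sin (of_real pi * z)"
  have z: "z \<notin> \<int>\<^sub>\<le>\<^sub>0" "1 - z \<notin> \<int>\<^sub>\<le>\<^sub>0"
    using assms Ints_diff[of 1 "1 - z"] nonpos_Ints_subset_Ints by auto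
  have sin: "sin (of_real pi * w) \<noteq> 0" if "w \<notin> \<int>" for w :: complex
  proof
    assume "sin (of_real pi * w) = 0"
    then obtain n :: int where "of_real pi * w = of_real (of_int n * pi)" by (auto simp: sin_eq_0)
    then have "w = of_int n" by simp
    with that show False by simp
  qed
  have "(?f has_field_derivative
      Gamma z * Gamma (1 - z) * ((Digamma z - Digamma (1 - z)) * sin (of_real pi * z) + of_real pi * cos (of_real pi * z))) (at z)"
    using z by (auto intro!: derivative_eq_intros simp: algebra_simps)
  moreover have "(?f has_field_derivative 0) (at z)"
  proof (rule has_field_derivative_transform_within_open[of "\<lambda>_. of_real pi" _ _ "- \<int>"])
    show "of_real pi = ?f w" if "w \<in> - \<int>" for w
      using that sin[of w] by (simp add: Gamma_reflection_complex)
  qed (use assms in \<open>auto simp: open_Compl closed_Ints\<close>)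
  ultimately have "Gamma z * Gamma (1 - z) *
      ((Digamma z - Digamma (1 - z)) * sin (of_real pi * z) + of_real pi * cos (of_real pi * z)) = 0"
    using DERIV_unique by blast
  moreover have "Gamma z \<noteq> 0" "Gamma (1 - z) \<noteq> 0" using z by (simp_all add: Gamma_eq_zero_iff)
  ultimately have "(Digamma z - Digamma (1 - z)) * sin (of_real pi * z) + of_real pi * cos (of_real pi * z) = 0"
    by simp
  then show ?thesis by (simp add: algebra_simps)
qed

text \<open>
  The same relation after \<open>\<pi> cot(\<pi> z)\<close> is written as \<open>\<pi> i (q + 1) / (q - 1)\<close> with
  \<open>q = exp(2 \<pi> i z)\<close>. In the upper half plane it expands as a geometric series in \<open>q\<close>; near 0 it
  is the generating function of the Bernoulli numbers.
\<close>
lemma Digamma_reflection_exp: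
  fixes z :: complex
  assumes "z \<notin> \<int>"
  shows "(Digamma (1 - z) - Digamma z) * (exp (2 * of_real pi * \<i> * z) - 1)
     = of_real pi * \<i> * (exp (2 * of_real pi * \<i> * z) + 1)"
proof -
  let ?e = "exp (\<i> * (of_real pi * z))"
  have q: "exp (2 * of_real pi * \<i> * z) = ?e * ?e"
    by (simp add: exp_add[symmetric] algebra_simps)
  have "?e * exp (- (\<i> * (of_real pi * z))) = 1" by (simp add: exp_minus)
  then have s: "2 * \<i> * ?e * sin (of_real pi * z) = ?e * ?e - 1"
    and c: "2 * ?e * cos (of_real pi * z) = ?e * ?e + 1"
    by (simp_all add: sin_exp_eq cos_exp_eq field_simps)
  have "(Digamma (1 - z) - Digamma z) * (2 * \<i> * ?e * sin (of_real pi * z)) =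
     2 * \<i> * ?e * ((Digamma (1 - z) - Digamma z) * sin (of_real pi * z))"
    by (simp only: mult_ac)
  also have "\<dots> = of_real pi * \<i> * (2 * ?e * cos (of_real pi * z))"
    unfolding Digamma_reflection[OF assms] by (simp only: mult_ac)
  finally have "(Digamma (1 - z) - Digamma z) * (2 * \<i> * ?e * sin (of_real pi * z)) =
     of_real pi * \<i> * (2 * ?e * cos (of_real pi * z))" .
  then show ?thesis unfolding q s c .
qed

lemma summable_power_times_geometric:
  fixes x :: complex
  assumes "norm x < 1"
  shows "summable (\<lambda>n. of_nat n ^ j * x ^ n)"
  using assms
proof (induction j arbitrary: x)
  case (Suc j)
  have "summable (\<lambda>n. diffs (\<lambda>n. of_nat n ^ j) n * x ^ n)"
    using Suc by (intro termdiff_converges[of x 1]) auto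
  from summable_mult[OF this, of x] show ?case
    by (subst summable_Suc_iff[symmetric]) (simp add: diffs_def mult_ac)
qed (simp add: summable_geometric)

lemma has_field_derivative_power_times_geometric:
  fixes x :: complex
  assumes "norm x < 1"
  obtains D where "((\<lambda>x. \<Sum>n. of_nat n ^ j * x ^ n) has_field_derivative D) (at x)"
    and "D * x = (\<Sum>n. of_nat n ^ Suc j * x ^ n)"
proof
  let ?c = "\<lambda>n. of_nat n ^ j :: complex"
  show "((\<lambda>x. \<Sum>n. ?c n * x ^ n) has_field_derivative (\<Sum>n. diffs ?c n * x ^ n)) (at x)"
    using assms by (intro termdiffs_strong'[of 1] summable_power_times_geometric)
  have "summable (\<lambda>n. diffs ?c n * x ^ n)"
    using assms by (intro termdiff_converges[of x 1] summable_power_times_geometric)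
  then have "(\<Sum>n. diffs ?c n * x ^ n) * x = (\<Sum>n. diffs ?c n * x ^ n * x)"
    by (simp add: suminf_mult2)
  also have "\<dots> = (\<Sum>n. of_nat (Suc n) ^ Suc j * x ^ Suc n)"
    by (simp add: diffs_def mult_ac)
  also have "\<dots> = (\<Sum>n. of_nat n ^ Suc j * x ^ n)"
    using suminf_split_head[OF summable_power_times_geometric[OF assms, of "Suc j"]] by simp
  finally show "(\<Sum>n. diffs ?c n * x ^ n) * x = (\<Sum>n. of_nat n ^ Suc j * x ^ n)" .
qed

lemma norm_q_less_1: "z \<in> upper_half_plane \<Longrightarrow> norm (exp (2 * of_real pi * \<i> * z)) < 1"
  by (simp add: upper_half_plane_def norm_exp_eq_Re)

lemma upper_half_plane_not_Ints: "z \<in> upper_half_plane \<Longrightarrow> z \<notin> \<int>"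
  by (auto simp: upper_half_plane_def elim!: Ints_cases)

lemma open_upper_half_plane: "open upper_half_plane"
  unfolding upper_half_plane_def by (rule open_halfspace_Im_gt)

text \<open>
  Differentiate \<open>\<psi>(1 - z) - \<psi>(z) = \<pi> i - 2 \<pi> i (1 + q + q\<^sup>2 + \<dots>)\<close> \<open>j\<close> times: each derivative
  brings down a factor \<open>2 \<pi> i n\<close> in the series, and the constant \<open>\<pi> i\<close> disappears for \<open>j > 0\<close>.
  Since polygamma values are sums of powers of \<open>1 / (z + k)\<close>, this is the Lipschitz formula in
  disguise.
\<close>
lemma Polygamma_reflection:
  assumes "z \<in> upper_half_plane"
  shows "(2 * of_real pi * \<i>) ^ Suc j * (\<Sum>n. of_nat n ^ j * exp (2 * of_real pi * \<i> * z) ^ n)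
    = (if j = 0 then of_real pi * \<i> else 0) - ((-1) ^ j * Polygamma j (1 - z) - Polygamma j z)"
  using assms
proof (induction j arbitrary: z)
  case 0
  let ?q = "exp (2 * of_real pi * \<i> * z)"
  have q: "norm ?q < 1" using norm_q_less_1 0 by blast
  then have "?q \<noteq> 1" by (metis less_irrefl norm_one)
  then show ?case using Digamma_reflection_exp[of z] upper_half_plane_not_Ints[OF 0] q
    by (simp add: suminf_geometric field_simps)
next
  case (Suc j)
  let ?q = "\<lambda>z. exp (2 * of_real pi * \<i> * z)"
  let ?F = "\<lambda>j x. \<Sum>n. of_nat n ^ j * x ^ n :: complex"
  obtain D where D: "(?F j has_field_derivative D) (at (?q z))" "D * ?q z = ?F (Suc j) (?q z)"
    using has_field_derivative_power_times_geometric norm_q_less_1[OF Suc.prems] by blast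
  have "((\<lambda>z. (2 * of_real pi * \<i>) ^ Suc j * ?F j (?q z)) has_field_derivative
      (2 * of_real pi * \<i>) ^ Suc j * (D * (?q z * (2 * of_real pi * \<i>)))) (at z)"
    by (intro DERIV_cmult DERIV_chain2[where g = ?q and x = z, OF D(1)])
      (auto intro!: derivative_eq_intros)
  moreover have "((\<lambda>z. (2 * of_real pi * \<i>) ^ Suc j * ?F j (?q z)) has_field_derivative
      - ((-1) ^ Suc j * Polygamma (Suc j) (1 - z) - Polygamma (Suc j) z)) (at z)"
  proof (rule has_field_derivative_transform_within_open)
    have "z \<notin> \<int>\<^sub>\<le>\<^sub>0" "1 - z \<notin> \<int>\<^sub>\<le>\<^sub>0"
      using upper_half_plane_not_Ints[OF Suc.prems] Ints_diff[of 1 "1 - z"] nonpos_Ints_subset_Ints by auto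
    then show "((\<lambda>z. (if j = 0 then of_real pi * \<i> else 0) - ((-1) ^ j * Polygamma j (1 - z) - Polygamma j z))
      has_field_derivative - ((-1) ^ Suc j * Polygamma (Suc j) (1 - z) - Polygamma (Suc j) z)) (at z)"
      by (auto intro!: derivative_eq_intros)
    show "z \<in> upper_half_plane" by fact
  qed (use Suc.IH open_upper_half_plane in auto)
  ultimately have "(2 * of_real pi * \<i>) ^ Suc j * (D * (?q z * (2 * of_real pi * \<i>)))
      = - ((-1) ^ Suc j * Polygamma (Suc j) (1 - z) - Polygamma (Suc j) z)"
    using DERIV_unique by blast
  moreover have "(2 * of_real pi * \<i>) ^ Suc (Suc j) * ?F (Suc j) (?q z)
      = (2 * of_real pi * \<i>) ^ Suc j * (D * (?q z * (2 * of_real pi * \<i>)))"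
    unfolding D(2)[symmetric] by (simp only: power_Suc mult_ac)
  ultimately show ?case by (simp only: nat.distinct if_False diff_0)
qed

lemma Polygamma_odd_suminf:
  assumes "odd j"
  shows "Polygamma j (z::complex) = fact j * (\<Sum>k. 1 / (z + of_nat k) ^ Suc j)"
  using assms by (cases j) (auto simp: Polygamma_def divide_inverse)

definition zeta_sum :: "nat \<Rightarrow> complex" where
  "zeta_sum w = (\<Sum>n. 1 / of_nat (Suc n) ^ w)"

text \<open>
  The quotient is exact: \<open>e\<^sup>x - 1\<close> has no constant term but a nonzero linear one.
\<close>
lemma bernoulli_fps_mult:
  "(fps_X / (fps_exp 1 - 1)) * (fps_exp 1 - 1) = (fps_X :: real fps)"
proof -
  have "subdegree (fps_exp 1 - 1 :: real fps) \<le> 1" by (rule subdegree_leI) simp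
  moreover have ne: "fps_exp 1 - 1 \<noteq> (0 :: real fps)"
  proof
    assume "fps_exp 1 - 1 = (0 :: real fps)"
    then have "fps_nth (fps_exp 1 - 1) 1 = (0::real)" by simp
    then show False by simp
  qed
  ultimately have "(fps_exp 1 - 1 :: real fps) dvd fps_X"
    by (subst fps_dvd_iff) auto
  then show ?thesis by simp
qed

text \<open>
  Writing \<open>\<psi>(1 + z)\<close> instead of \<open>\<psi>(z)\<close> removes the pole at 0, so that Taylor coefficients at 0 can
  be read off.
\<close>
lemma Digamma_difference_higher_deriv:
  assumes "z \<in> ball 0 1"
  shows "(deriv ^^ n) (\<lambda>z::complex. Digamma (1 - z) - Digamma (1 + z)) z
     = (-1) ^ n * Polygamma n (1 - z) - Polygamma n (1 + z)"
  using assms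
proof (induction n arbitrary: z)
  case (Suc n)
  have nz: "1 + w \<notin> \<int>\<^sub>\<le>\<^sub>0" if "w \<in> ball 0 1" for w :: complex
  proof
    assume "1 + w \<in> \<int>\<^sub>\<le>\<^sub>0"
    then obtain m where "1 + w = - of_nat m" by (auto elim!: nonpos_Ints_cases')
    then have "w = - of_nat m - 1" by (metis add_diff_cancel_left')
    then have "w = - of_nat (Suc m)" by simp
    then have "norm w = real (Suc m)" by (metis norm_minus_cancel norm_of_nat)
    with that show False by simp
  qed
  have "eventually (\<lambda>w. w \<in> ball 0 1) (nhds z)" using Suc.prems by (intro eventually_nhds_in_open) auto
  then have "eventually (\<lambda>w. (deriv ^^ n) (\<lambda>z::complex. Digamma (1 - z) - Digamma (1 + z)) w
     = (-1) ^ n * Polygamma n (1 - w) - Polygamma n (1 + w)) (nhds z)"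
    by eventually_elim (rule Suc.IH)
  then have "(deriv ^^ Suc n) (\<lambda>z::complex. Digamma (1 - z) - Digamma (1 + z)) z
     = deriv (\<lambda>w. (-1) ^ n * Polygamma n (1 - w) - Polygamma n (1 + w)) z"
    by (simp add: deriv_cong_ev)
  also have "\<dots> = (-1) ^ Suc n * Polygamma (Suc n) (1 - z) - Polygamma (Suc n) (1 + z)"
    using nz[of z] nz[of "-z"] Suc.prems
    by (intro DERIV_imp_deriv) (auto intro!: derivative_eq_intros)
  finally show ?case .
qed simp

text \<open>
  Euler's formula. By the reflection formula, \<open>\<Psi>(z) = \<psi>(1 - z) - \<psi>(1 + z)\<close> satisfies
  \<open>(z (\<Psi>(z) - \<pi> i) + 1) (exp(2 \<pi> i z) - 1) = 2 \<pi> i z\<close>, which says that \<open>z (\<Psi>(z) - \<pi> i) + 1\<close> is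
  \<open>x / (e\<^sup>x - 1)\<close> at \<open>x = 2 \<pi> i z\<close>. Comparing the coefficients of \<open>z\<^sup>w\<close> gives the Bernoulli number on
  one side and a polygamma value at 1, that is \<open>\<zeta>(w)\<close>, on the other.
\<close>
lemma zeta_even_bernoulli:
  assumes "even w" "w > 0"
  shows "2 * zeta_sum w = - ((2 * of_real pi * \<i>) ^ w * of_real (bernoulli_number w) / fact w)"
proof -
  define Psi where "Psi = (\<lambda>z::complex. Digamma (1 - z) - Digamma (1 + z))"
  let ?c = "2 * of_real pi * \<i>"
  have "Psi analytic_on {0}"
    unfolding Psi_def by (intro analytic_intros) auto
  then have P: "Psi has_fps_expansion fps_expansion Psi 0" (is "_ has_fps_expansion ?P")
    by (rule analytic_at_imp_has_fps_expansion_0)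
  have "(\<lambda>z. (z * (Psi z - of_real pi * \<i>) + 1) * (exp (?c * z) - 1)) has_fps_expansion
     (fps_X * (?P - fps_const (of_real pi * \<i>)) + 1) * (fps_exp ?c - 1)"
    by (intro fps_expansion_intros P)
  moreover have "(\<lambda>z. ?c * z) has_fps_expansion fps_const ?c * fps_X"
    by (intro fps_expansion_intros)
  moreover have "eventually (\<lambda>z. (z * (Psi z - of_real pi * \<i>) + 1) * (exp (?c * z) - 1) = ?c * z) (nhds 0)"
  proof -
    have "eventually (\<lambda>z::complex. z \<in> ball 0 1) (nhds 0)" by (intro eventually_nhds_in_open) auto
    then show ?thesis
    proof eventually_elim
      case (elim z)
      show ?case
      proof (cases "z = 0")
        case False
        have "z \<notin> \<int>" using elim False by (auto elim!: Ints_cases)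
        from Digamma_reflection_exp[OF this] have
          *: "(Digamma (1 - z) - Digamma z) * (exp (?c * z) - 1) = of_real pi * \<i> * (exp (?c * z) + 1)" .
        have "z * Psi z = z * (Digamma (1 - z) - Digamma z) - 1"
        proof -
          have "Psi z = Digamma (1 - z) - Digamma z - 1 / z"
            using Digamma_plus1[OF False] by (simp add: Psi_def add.commute[of 1])
          then show ?thesis using False by (simp add: right_diff_distrib)
        qed
        then have "(z * (Psi z - of_real pi * \<i>) + 1) * (exp (?c * z) - 1)
          = z * ((Digamma (1 - z) - Digamma z) * (exp (?c * z) - 1)) - of_real pi * \<i> * z * (exp (?c * z) - 1)"
          by algebra
        also have "\<dots> = ?c * z" unfolding * by algebra
        finally show ?thesis .
      qed auto
    qed
  qed
  note ev = this
  from has_fps_expansion_cong[OF ev refl] calculation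
  have "(\<lambda>z. ?c * z) has_fps_expansion (fps_X * (?P - fps_const (of_real pi * \<i>)) + 1) * (fps_exp ?c - 1)"
    by simp
  then have fps1: "(fps_X * (?P - fps_const (of_real pi * \<i>)) + 1) * (fps_exp ?c - 1) = fps_const ?c * fps_X"
    using \<open>(\<lambda>z. ?c * z) has_fps_expansion fps_const ?c * fps_X\<close> fps_expansion_unique_complex by blast
  define B where "B = (fps_X / (fps_exp 1 - 1) :: real fps)"
  \<comment> \<open>The Bernoulli series over \<open>\<complex>\<close>, with \<open>2 \<pi> i X\<close> substituted for \<open>X\<close>.\<close>
  define B' where "B' = Abs_fps (\<lambda>n. of_real (fps_nth B n) * ?c ^ n)"
  have "B' * (fps_exp ?c - 1) = fps_const ?c * fps_X"
  proof (rule fps_ext)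
    fix n
    have "fps_nth (fps_exp ?c - 1) m = of_real (fps_nth (fps_exp 1 - 1) m) * ?c ^ m" for m
      by (cases m) auto
    then have "fps_nth (B' * (fps_exp ?c - 1)) n =
      (\<Sum>i=0..n. of_real (fps_nth B i) * ?c ^ i * (of_real (fps_nth (fps_exp 1 - 1) (n - i)) * ?c ^ (n - i)))"
      by (simp only: fps_mult_nth B'_def fps_nth_Abs_fps)
    also have "\<dots> = (\<Sum>i=0..n. of_real (fps_nth B i * fps_nth (fps_exp 1 - 1) (n - i)) * ?c ^ n)"
    proof (rule sum.cong)
      fix i assume "i \<in> {0..n}"
      then have "?c ^ n = ?c ^ i * ?c ^ (n - i)" by (simp flip: power_add)
      then show "of_real (fps_nth B i) * ?c ^ i * (of_real (fps_nth (fps_exp 1 - 1) (n - i)) * ?c ^ (n - i))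
        = of_real (fps_nth B i * fps_nth (fps_exp 1 - 1) (n - i)) * ?c ^ n"
        by (simp only: of_real_mult mult_ac)
    qed auto
    also have "\<dots> = of_real (fps_nth (B * (fps_exp 1 - 1)) n) * ?c ^ n"
      by (simp only: fps_mult_nth sum_distrib_right of_real_sum)
    also have "\<dots> = fps_nth (fps_const ?c * fps_X) n"
      unfolding B_def bernoulli_fps_mult by (auto simp: le_Suc_eq)
    finally show "fps_nth (B' * (fps_exp ?c - 1)) n = fps_nth (fps_const ?c * fps_X) n" .
  qed
  with fps1 have "B' * (fps_exp ?c - 1) = (fps_X * (?P - fps_const (of_real pi * \<i>)) + 1) * (fps_exp ?c - 1)" by simp
  moreover have "fps_exp ?c - 1 \<noteq> 0"
  proof
    assume "fps_exp ?c - 1 = 0"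
    then have "fps_nth (fps_exp ?c - 1) 1 = 0" by simp
    then show False by simp
  qed
  ultimately have B': "B' = fps_X * (?P - fps_const (of_real pi * \<i>)) + 1" by simp
  obtain j where j: "w = Suc j" "odd j" using assms by (cases w) auto
  then have "j > 0" by (cases j) auto
  have "fps_nth B' w = fps_nth ?P j"
    unfolding B' j using \<open>j > 0\<close> by simp
  also have "\<dots> = - 2 * Polygamma j 1 / fact j"
    using fps_nth_fps_expansion[OF P, of j] Digamma_difference_higher_deriv[of 0 j] j
    by (simp add: Psi_def)
  also have "\<dots> = - 2 * zeta_sum w"
    using Polygamma_odd_suminf[OF j(2), of 1] by (simp add: zeta_sum_def j)
  finally show ?thesis
    by (simp add: B'_def B_def bernoulli_number_def j(1) del: fact_Suc)
qed

section \<open>Lattice sums and the Lipschitz formula\<close>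

lemma nonneg_summable_on_product:
  fixes f :: "'a \<Rightarrow> real" and g :: "'b \<Rightarrow> real"
  assumes "f summable_on A" "g summable_on B" "\<And>x. f x \<ge> 0" "\<And>y. g y \<ge> 0"
  shows "(\<lambda>(x, y). f x * g y) summable_on A \<times> B"
proof (rule summable_on_SigmaI)
  show "((\<lambda>y. case (x, y) of (x, y) \<Rightarrow> f x * g y) has_sum f x * infsum g B) B" for x
    using assms(2) by (simp add: has_sum_cmult_right)
  show "(\<lambda>x. f x * infsum g B) summable_on A"
    using assms(1) by (rule summable_on_cmult_left)
qed (use assms in auto)

lemma summable_on_nat_imp_int:
  fixes f :: "int \<Rightarrow> real"
  assumes "(\<lambda>n. f (int n)) summable_on UNIV" "(\<lambda>n. f (- int n)) summable_on UNIV"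
  shows "f summable_on UNIV"
proof -
  have "f summable_on range int"
    using assms(1) by (subst summable_on_reindex) (auto simp: o_def)
  moreover have "f summable_on range (\<lambda>n. - int n)"
    using assms(2) by (subst summable_on_reindex) (auto simp: o_def inj_on_def)
  ultimately have "f summable_on range int \<union> range (\<lambda>n. - int n)"
    by (rule summable_on_union)
  also have "range int \<union> range (\<lambda>n. - int n) = UNIV"
    by (auto simp: image_iff) (metis int_cases2)
  finally show ?thesis .
qed

lemma inverse_square_summable_int: "(\<lambda>m::int. 1 / (max 1 \<bar>of_int m :: real\<bar>)\<^sup>2) summable_on UNIV"
proof -
  have "summable (\<lambda>n. inverse (real (Suc n) ^ 2))"
    unfolding summable_Suc_iff[of "\<lambda>n. inverse (real n ^ 2)"] by (rule inverse_power_summable) simp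
  then have "summable (\<lambda>n. 1 / (max 1 (real (Suc n)))\<^sup>2)"
    by (simp add: divide_inverse max_def)
  then have "summable (\<lambda>n. 1 / (max 1 (real n))\<^sup>2)"
    by (subst (asm) summable_Suc_iff)
  then have "(\<lambda>n. 1 / (max 1 (real n))\<^sup>2) summable_on UNIV"
    by (intro summable_nonneg_imp_summable_on) auto
  then show ?thesis by (intro summable_on_nat_imp_int) auto
qed

text \<open>
  Both \<open>\<bar>m\<bar>\<close> and \<open>\<bar>n\<bar>\<close> are bounded by a multiple of \<open>\<bar>m z + n\<bar>\<close>. Since \<open>w \<ge> 4\<close>, the terms are
  dominated by a product of \<open>1 / m\<^sup>2\<close> and \<open>1 / n\<^sup>2\<close> (with 0 replaced by 1), so a comparison with the
  square of a convergent series suffices.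
\<close>
lemma lattice_summable:
  assumes "z \<in> upper_half_plane" "w \<ge> 4"
  shows "(\<lambda>(m, n). 1 / (of_int m * z + of_int n) ^ w) summable_on (UNIV - {(0, 0)})"
proof (rule abs_summable_summable, rule Infinite_Sum.abs_summable_on_comparison_test')
  \<comment> \<open>The first summand serves to bound \<open>m\<close>, the other two to bound \<open>n = (m z + n) - m z\<close>.\<close>
  define K where "K = 1 / Im z + 1 + norm z / Im z"
  have y: "Im z > 0" using assms by (simp add: upper_half_plane_def)
  then have K: "K > 0" by (simp add: K_def add_pos_nonneg)
  let ?g = "\<lambda>m::int. 1 / (max 1 \<bar>of_int m :: real\<bar>)\<^sup>2"
  have "(\<lambda>(m, n). ?g m * ?g n) summable_on UNIV \<times> UNIV"
    by (intro nonneg_summable_on_product inverse_square_summable_int) auto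
  then show "(\<lambda>(m, n). K ^ w * (?g m * ?g n)) summable_on UNIV - {(0, 0)}"
    unfolding split_def by (rule summable_on_cmult_right[OF summable_on_subset_banach]) auto
  fix p :: "int \<times> int" assume "p \<in> UNIV - {(0, 0)}"
  then obtain m n where [simp]: "p = (m, n)" and mn: "(m, n) \<noteq> (0, 0)" by (cases p) auto
  define t where "t = norm (of_int m * z + of_int n)"
  have "\<bar>of_int m\<bar> * Im z = \<bar>Im (of_int m * z + of_int n)\<bar>" using y by (simp add: abs_mult)
  also have "\<dots> \<le> t" unfolding t_def by (rule abs_Im_le_cmod)
  finally have m: "\<bar>of_int m\<bar> \<le> t / Im z" using y by (simp add: field_simps)
  have "\<bar>of_int n :: real\<bar> = norm ((of_int m * z + of_int n) - of_int m * z)" by simp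
  also have "\<dots> \<le> t + \<bar>of_int m\<bar> * norm z" unfolding t_def
    by (metis norm_mult norm_of_int norm_triangle_ineq4)
  also have "\<dots> \<le> t + t / Im z * norm z" using m by (intro add_mono mult_right_mono) auto
  finally have n: "\<bar>of_int n\<bar> \<le> t + t * norm z / Im z" by simp
  have t: "t \<ge> 0" by (simp add: t_def)
  have Kt: "K * t = t / Im z + t + t * norm z / Im z" by (simp add: K_def field_simps)
  have m': "\<bar>of_int m\<bar> \<le> K * t" and n': "\<bar>of_int n\<bar> \<le> K * t"
    using m n t y by (auto simp: Kt intro: order_trans)
  have "1 \<le> K * t"
  proof (cases "m = 0")
    case True
    with mn have "\<bar>n\<bar> \<ge> 1" by auto
    then have "\<bar>of_int n :: real\<bar> \<ge> 1" by linarith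
    with n' show ?thesis by simp
  next
    case False
    then have "\<bar>m\<bar> \<ge> 1" by auto
    then have "\<bar>of_int m :: real\<bar> \<ge> 1" by linarith
    with m' show ?thesis by simp
  qed
  let ?a = "max 1 \<bar>of_int m :: real\<bar>" and ?b = "max 1 \<bar>of_int n :: real\<bar>"
  have "?a\<^sup>2 * ?b\<^sup>2 \<le> (K * t)\<^sup>2 * (K * t)\<^sup>2"
    using \<open>1 \<le> K * t\<close> m' n' by (intro mult_mono power_mono) auto
  also have "\<dots> = (K * t) ^ 4" by (simp flip: power_add)
  also have "\<dots> \<le> (K * t) ^ w" using \<open>1 \<le> K * t\<close> assms(2) by (rule power_increasing[rotated])
  finally have le: "?a\<^sup>2 * ?b\<^sup>2 \<le> K ^ w * t ^ w" by (simp add: power_mult_distrib)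
  have "t > 0" using \<open>1 \<le> K * t\<close> t by (cases "t = 0") auto
  have "?a\<^sup>2 * ?b\<^sup>2 > 0" by (intro mult_pos_pos zero_less_power) auto
  then have "1 / t ^ w \<le> K ^ w * (1 / ?a\<^sup>2 * (1 / ?b\<^sup>2))"
    using le \<open>t > 0\<close> by (simp only: divide_le_eq le_divide_eq times_divide_eq_left times_divide_eq_right mult_1_left mult_1_right divide_divide_eq_left) (auto simp: mult_ac divide_le_eq le_divide_eq)
  then show "norm (case p of (m, n) \<Rightarrow> 1 / (of_int m * z + of_int n) ^ w)
     \<le> (case p of (m, n) \<Rightarrow> K ^ w * (?g m * ?g n))"
    by (simp add: norm_divide norm_power t_def)
qed

lemma infsum_int_split:
  fixes f :: "int \<Rightarrow> complex"
  assumes "f summable_on UNIV"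
  shows "infsum f UNIV = (\<Sum>n. f (int n)) + (\<Sum>n. f (- int (Suc n)))"
proof -
  have U: "(UNIV :: int set) = range int \<union> range (\<lambda>n. - int (Suc n))"
  proof (intro equalityI subsetI)
    fix n :: int
    show "n \<in> range int \<union> range (\<lambda>n. - int (Suc n))" by (cases n) blast+
  qed simp
  have s: "f summable_on A" for A by (rule summable_on_subset_banach[OF assms]) simp
  have "infsum f UNIV = infsum f (range int) + infsum f (range (\<lambda>n. - int (Suc n)))"
    unfolding U by (rule infsum_Un_disjoint) (auto intro: s)
  moreover have "infsum f (range g) = (\<Sum>n. f (g n))" if "inj g" for g
  proof -
    have "(f has_sum infsum f (range g)) (range g)" using s by simp
    then have "((f \<circ> g) has_sum infsum f (range g)) UNIV"
      using that by (subst (asm) has_sum_reindex) auto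
    from has_sum_imp_sums[OF this] show ?thesis by (simp add: sums_iff o_def)
  qed
  ultimately show ?thesis by (simp add: inj_on_def)
qed

lemma infsum_nonzero_int_even:
  fixes f :: "int \<Rightarrow> complex"
  assumes "f summable_on (UNIV - {0})" "\<And>n. f (- n) = f n"
  shows "infsum f (UNIV - {0}) = 2 * (\<Sum>n. f (int (Suc n)))"
    and "summable (\<lambda>n. f (int (Suc n)))"
proof -
  have U: "UNIV - {0::int} = range (\<lambda>n. int (Suc n)) \<union> range (\<lambda>n. - int (Suc n))"
  proof (intro equalityI subsetI)
    fix n :: int assume "n \<in> UNIV - {0}"
    then consider "n = int (Suc (nat n - 1))" | "n = - int (Suc (nat (- n) - 1))" by fastforce
    then show "n \<in> range (\<lambda>n. int (Suc n)) \<union> range (\<lambda>n. - int (Suc n))" by cases blast+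
  qed (auto simp del: of_nat_Suc)
  have s: "f summable_on A" if "0 \<notin> A" for A using that by (intro summable_on_subset_banach[OF assms(1)]) auto
  have *: "infsum f (range g) = (\<Sum>n. f (g n)) \<and> summable (\<lambda>n. f (g n))" if "inj g" "0 \<notin> range g" for g
  proof -
    have "(f has_sum infsum f (range g)) (range g)" using s[OF that(2)] by simp
    then have "((f \<circ> g) has_sum infsum f (range g)) UNIV"
      using that by (subst (asm) has_sum_reindex) auto
    from has_sum_imp_sums[OF this] show ?thesis by (simp add: sums_iff o_def)
  qed
  have "infsum f (UNIV - {0}) = infsum f (range (\<lambda>n. int (Suc n))) + infsum f (range (\<lambda>n. - int (Suc n)))"
    unfolding U by (rule infsum_Un_disjoint) (auto intro!: s)
  then show "infsum f (UNIV - {0}) = 2 * (\<Sum>n. f (int (Suc n)))"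
    using *[of "\<lambda>n. int (Suc n)"] *[of "\<lambda>n. - int (Suc n)"] assms(2) by (simp add: inj_on_def image_iff del: of_nat_Suc)
  show "summable (\<lambda>n. f (int (Suc n)))"
    using *[of "\<lambda>n. int (Suc n)"] by (simp add: inj_on_def image_iff del: of_nat_Suc)
qed

lemma lattice_row_summable:
  assumes "z \<in> upper_half_plane" "w \<ge> 4" "m \<noteq> 0"
  shows "(\<lambda>n::int. 1 / (of_int m * z + of_int n) ^ w) summable_on UNIV"
proof -
  have "(\<lambda>(m, n). 1 / (of_int m * z + of_int n) ^ w) summable_on ({m} \<times> UNIV)"
    by (rule summable_on_subset_banach[OF lattice_summable[OF assms(1,2)]]) (use assms(3) in auto)
  then show ?thesis by (rule summable_on_SigmaD1) simp
qed

text \<open>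
  The terms with \<open>n \<ge> 0\<close> and those with \<open>n < 0\<close> sum to polygamma values at \<open>z\<close> and at \<open>1 - z\<close>, as
  \<open>w\<close> is even; the reflection formula for polygamma functions gives their sum.
\<close>
lemma lipschitz_formula:
  assumes "z \<in> upper_half_plane" "w \<ge> 4" "even w"
  shows "infsum (\<lambda>n::int. 1 / (z + of_int n) ^ w) UNIV
    = (2 * of_real pi * \<i>) ^ w / fact (w - 1) * (\<Sum>n. of_nat n ^ (w - 1) * exp (2 * of_real pi * \<i> * z) ^ n)"
proof -
  obtain j where j: "w = Suc j" "odd j" using assms by (cases w) auto
  have "infsum (\<lambda>n::int. 1 / (z + of_int n) ^ w) UNIV = (\<Sum>k. 1 / (z + of_nat k) ^ w) + (\<Sum>k. 1 / (1 - z + of_nat k) ^ w)"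
  proof (subst infsum_int_split)
    show "(\<lambda>n::int. 1 / (z + of_int n) ^ w) summable_on UNIV"
      using lattice_row_summable[of z w 1] assms by simp
    have "(z + of_int (- int (Suc k))) ^ w = (1 - z + of_nat k) ^ w" for k
      using power_minus_even[of w "1 - z + of_nat k"] assms(3) by (simp add: algebra_simps)
    then show "(\<Sum>n. 1 / (z + of_int (int n)) ^ w) + (\<Sum>n. 1 / (z + of_int (- int (Suc n))) ^ w)
      = (\<Sum>k. 1 / (z + of_nat k) ^ w) + (\<Sum>k. 1 / (1 - z + of_nat k) ^ w)" by (simp only: of_int_of_nat_eq)
  qed
  moreover have "(2 * of_real pi * \<i>) ^ w * (\<Sum>n. of_nat n ^ j * exp (2 * of_real pi * \<i> * z) ^ n)
      = fact j * ((\<Sum>k. 1 / (z + of_nat k) ^ w) + (\<Sum>k. 1 / (1 - z + of_nat k) ^ w))"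
    using Polygamma_reflection[OF assms(1), of j] j odd_pos[OF j(2)]
    by (simp add: Polygamma_odd_suminf[OF j(2)] distrib_left del: power_Suc)
  ultimately show ?thesis by (simp add: j nonzero_eq_divide_eq mult.commute del: power_Suc)
qed


text \<open>
  The classical Eisenstein series \<open>G\<^sub>w\<close>: its invariance under the full modular group is a mere
  rearrangement of terms.
\<close>
definition lattice_sum :: "nat \<Rightarrow> complex \<Rightarrow> complex" where
  "lattice_sum w z = infsum (\<lambda>(m, n). 1 / (of_int m * z + of_int n) ^ w) (UNIV - {(0, 0)})"

lemma zeta_sum_nonzero:
  assumes "w \<ge> 2"
  shows "zeta_sum w \<noteq> 0"
proof -
  have "summable (\<lambda>n. inverse (real (Suc n) ^ w))"
    unfolding summable_Suc_iff[of "\<lambda>n. inverse (real n ^ w)"] by (rule inverse_power_summable) (use assms in simp)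
  then have s: "summable (\<lambda>n. 1 / real (Suc n) ^ w)" by (simp add: divide_inverse)
  then have "(\<Sum>n. 1 / real (Suc n) ^ w) > 0" by (intro suminf_pos) auto
  moreover have "zeta_sum w = of_real (\<Sum>n. 1 / real (Suc n) ^ w)"
    unfolding zeta_sum_def using suminf_of_real[OF s, where 'a=complex] by simp
  ultimately show ?thesis by (metis less_irrefl of_real_eq_0_iff)
qed

lemma zeta_sum_infsum:
  assumes "w \<ge> 2"
  shows "(\<lambda>n. 1 / of_nat n ^ w :: complex) summable_on {1..}"
    and "infsum (\<lambda>n. 1 / of_nat n ^ w :: complex) {1..} = zeta_sum w"
proof -
  have "summable (\<lambda>n. inverse (real (Suc n) ^ w))"
    unfolding summable_Suc_iff[of "\<lambda>n. inverse (real n ^ w)"] by (rule inverse_power_summable) (use assms in simp)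
  then have "summable (\<lambda>n. norm (1 / of_nat (Suc n) ^ w :: complex))"
    by (simp add: divide_inverse norm_mult norm_inverse norm_power del: of_nat_Suc)
  then have hs: "((\<lambda>n. 1 / of_nat (Suc n) ^ w :: complex) has_sum zeta_sum w) UNIV"
    unfolding zeta_sum_def by (rule norm_summable_imp_has_sum) (rule summable_sums[OF summable_norm_cancel], fact)
  have "((\<lambda>n. 1 / of_nat n ^ w :: complex) has_sum zeta_sum w) (range Suc)"
    using hs by (subst has_sum_reindex) (auto simp: o_def)
  moreover have "range Suc = {1..}" by (metis One_nat_def atLeast_Suc_greaterThan greaterThan_0)
  ultimately show "(\<lambda>n. 1 / of_nat n ^ w :: complex) summable_on {1..}"
    "infsum (\<lambda>n. 1 / of_nat n ^ w :: complex) {1..} = zeta_sum w"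
    by (simp_all add: has_sum_iff)
qed

text \<open>
  Since \<open>w\<close> is even, the rows \<open>m\<close> and \<open>-m\<close> contribute the same, and the row \<open>m = 0\<close> contributes
  \<open>2 \<zeta>(w)\<close>.
\<close>
lemma lattice_sum_rows:
  assumes "z \<in> upper_half_plane" "w \<ge> 4" "even w"
  defines "H \<equiv> \<lambda>m. infsum (\<lambda>n::int. 1 / (of_nat (Suc m) * z + of_int n) ^ w) UNIV"
  shows "lattice_sum w z = 2 * zeta_sum w + 2 * (\<Sum>m. H m)"
proof -
  let ?f = "\<lambda>(m, n). 1 / (of_int m * z + of_int n) ^ w"
  let ?H = "\<lambda>m::int. infsum (\<lambda>n::int. 1 / (of_int m * z + of_int n) ^ w) UNIV"
  have s: "?f summable_on A" if "A \<subseteq> UNIV - {(0, 0)}" for A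
    by (rule summable_on_subset_banach[OF lattice_summable[OF assms(1,2)] that])
  have U: "UNIV - {(0, 0)} = ({0::int} \<times> (UNIV - {0::int})) \<union> ((UNIV - {0}) \<times> UNIV)" by auto
  have "lattice_sum w z = infsum ?f ({0} \<times> (UNIV - {0})) + infsum ?f ((UNIV - {0}) \<times> UNIV)"
    unfolding lattice_sum_def U by (rule infsum_Un_disjoint) (auto intro!: s)
  moreover have "infsum ?f ({0} \<times> (UNIV - {0})) = 2 * zeta_sum w"
  proof -
    have sm: "(\<lambda>n::int. 1 / (of_int 0 * z + of_int n) ^ w) summable_on (UNIV - {0})"
      by (rule summable_on_SigmaD1[of _ "{0}"]) (auto intro!: s)
    have "infsum ?f ({0} \<times> (UNIV - {0})) = infsum (\<lambda>n::int. 1 / of_int n ^ w) (UNIV - {0})"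
      by (subst infsum_Sigma_banach[symmetric]) (auto intro!: s)
    also have "\<dots> = 2 * zeta_sum w"
      using sm assms(3) by (subst infsum_nonzero_int_even) (auto simp: zeta_sum_def)
    finally show ?thesis .
  qed
  moreover have "infsum ?f ((UNIV - {0}) \<times> UNIV) = 2 * (\<Sum>m. H m)"
  proof -
    have "infsum ?f ((UNIV - {0}) \<times> UNIV) = infsum ?H (UNIV - {0})"
      by (subst infsum_Sigma_banach[symmetric]) (auto intro!: s)
    also have "\<dots> = 2 * (\<Sum>m. ?H (int (Suc m)))"
    proof (rule infsum_nonzero_int_even(1))
      have "?f summable_on ((UNIV - {0}) \<times> UNIV)" by (rule s) auto
      from summable_on_Sigma_banach[OF this] show "?H summable_on (UNIV - {0})" by simp
      show "?H (- m) = ?H m" for m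
      proof -
        have "?H (- m) = infsum (\<lambda>n::int. 1 / (of_int (- m) * z + of_int (- n)) ^ w) UNIV"
          by (rule infsum_reindex_bij_witness[of _ uminus uminus]) auto
        moreover have "(of_int (- m) * z + of_int (- n)) ^ w = (of_int m * z + of_int n) ^ w" for n
          using power_minus_even[OF assms(3), of "of_int m * z + of_int n"] by simp
        ultimately show ?thesis by (simp only:)
      qed
    qed
    finally show ?thesis by (simp add: H_def)
  qed
  ultimately show ?thesis by simp
qed

text \<open>
  Collect the terms of the double series \<open>\<Sum> n\<^sup>j q\<^sup>m\<^sup>n\<close> according to \<open>N = m n\<close>. Absolute convergence
  follows from \<open>m n \<ge> m + n - 1\<close>, which dominates the double series by a product of two series.
\<close>
lemma lambert_series:
  fixes q :: complex
  assumes "norm q < 1" "j > 0"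
  obtains L where "(\<lambda>N. of_nat (\<Sum>d | d dvd Suc N. d ^ j) * q ^ Suc N) sums L"
    and "(\<lambda>m. \<Sum>n. of_nat n ^ j * (q ^ Suc m) ^ n) sums L"
proof -
  let ?g = "\<lambda>(m, n). of_nat n ^ j * (q ^ m) ^ n"
  have S: "range Suc = {1..}" by (metis One_nat_def atLeast_Suc_greaterThan greaterThan_0)
  have s: "?g summable_on ({1..} \<times> {1..})"
  proof (rule abs_summable_summable, rule Infinite_Sum.abs_summable_on_comparison_test')
    define r where "r = norm q"
    have r: "0 \<le> r" "r < 1" using assms by (auto simp: r_def)
    have "(\<lambda>n. r ^ n) summable_on UNIV"
      using r by (intro summable_nonneg_imp_summable_on summable_geometric) auto
    moreover have "(\<lambda>n. real n ^ j * r ^ n) summable_on UNIV"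
    proof (rule summable_nonneg_imp_summable_on)
      have "summable (\<lambda>n. complex_of_real (real n ^ j * r ^ n))"
        using summable_power_times_geometric[of "of_real r" j] r by simp
      then show "summable (\<lambda>n. real n ^ j * r ^ n)" by (simp only: summable_of_real_iff)
    qed (use r in auto)
    ultimately have "(\<lambda>(m, n). r ^ m * (real n ^ j * r ^ n)) summable_on UNIV \<times> UNIV"
      using r by (intro nonneg_summable_on_product) auto
    then have "(\<lambda>(m, n). r ^ m * (real n ^ j * r ^ n)) summable_on (\<lambda>(m, n). (m - 1, n)) ` ({1..} \<times> {1..})"
      by (rule summable_on_subset_banach) auto
    then show "(\<lambda>(m, n). r ^ (m - 1) * (real n ^ j * r ^ n)) summable_on {1..} \<times> {1..}"
      by (subst (asm) summable_on_reindex) (auto simp: inj_on_def o_def split_def)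
    fix p :: "nat \<times> nat" assume "p \<in> {1..} \<times> {1..}"
    then obtain m n where [simp]: "p = (Suc m, Suc n)" by (cases p) (auto simp: Suc_le_eq gr0_conv_Suc)
    have "r ^ (Suc m * Suc n) \<le> r ^ (m + Suc n)" using r by (intro power_decreasing) auto
    moreover have "norm (?g p) = real (Suc n) ^ j * r ^ (Suc m * Suc n)"
      unfolding \<open>p = _\<close> split norm_mult norm_power norm_of_nat r_def power_mult ..
    moreover have "(case p of (m, n) \<Rightarrow> r ^ (m - 1) * (real n ^ j * r ^ n)) = real (Suc n) ^ j * (r ^ m * r ^ Suc n)"
      by (simp add: mult.left_commute)
    ultimately show "norm (?g p) \<le> (case p of (m, n) \<Rightarrow> r ^ (m - 1) * (real n ^ j * r ^ n))"
      using r by (simp only: power_add) (intro mult_left_mono, auto)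
  qed
  let ?h = "\<lambda>(N, d). of_nat d ^ j * q ^ N"
  have bij: "bij_betw (\<lambda>(m, n). (m * n, n)) ({1..} \<times> {1..}) (SIGMA N:{1..}. {d::nat. d dvd N})"
    by (rule bij_betw_byWitness[where f' = "\<lambda>(N, d). (N div d, d)"])
      (auto simp: Suc_le_eq dvd_imp_le dest: dvd_imp_le intro: gr0I)
  have hg: "?h ((\<lambda>(m, n). (m * n, n)) p) = ?g p" for p by (cases p) (simp add: power_mult)
  have hs: "?h summable_on (SIGMA N:{1..}. {d. d dvd N})"
    using s by (subst summable_on_reindex_bij_betw[OF bij, symmetric]) (simp add: hg)
  have "infsum ?g ({1..} \<times> {1..}) = infsum ?h (SIGMA N:{1..}. {d. d dvd N})"
    by (subst infsum_reindex_bij_betw[OF bij, symmetric]) (simp add: hg)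
  also have "\<dots> = infsum (\<lambda>N. of_nat (\<Sum>d | d dvd N. d ^ j) * q ^ N) {1..}"
    by (subst infsum_Sigma_banach[OF hs, symmetric], rule infsum_cong) (simp add: sum_distrib_right)
  finally have eq: "infsum ?g ({1..} \<times> {1..}) = infsum (\<lambda>N. of_nat (\<Sum>d | d dvd N. d ^ j) * q ^ N) {1..}" .
  have "(\<lambda>N. of_nat (\<Sum>d | d dvd N. d ^ j) * q ^ N) summable_on {1..}"
    using summable_on_Sigma_banach[OF hs]
    by (rule summable_on_cong[THEN iffD1, rotated]) (simp add: sum_distrib_right)
  then have "((\<lambda>N. of_nat (\<Sum>d | d dvd N. d ^ j) * q ^ N) has_sum infsum ?g ({1..} \<times> {1..})) (range Suc)"
    unfolding eq S by simp
  then have "((\<lambda>N. of_nat (\<Sum>d | d dvd Suc N. d ^ j) * q ^ Suc N) has_sum infsum ?g ({1..} \<times> {1..})) UNIV"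
    by (subst (asm) has_sum_reindex) (auto simp: o_def)
  from has_sum_imp_sums[OF this]
  have "(\<lambda>N. of_nat (\<Sum>d | d dvd Suc N. d ^ j) * q ^ Suc N) sums infsum ?g ({1..} \<times> {1..})" .
  moreover have "(\<lambda>m. \<Sum>n. of_nat n ^ j * (q ^ Suc m) ^ n) sums infsum ?g ({1..} \<times> {1..})"
  proof -
    have inner: "infsum (\<lambda>n. of_nat n ^ j * (q ^ m) ^ n) {1..} = (\<Sum>n. of_nat n ^ j * (q ^ m) ^ n)" if "m \<ge> 1" for m
    proof -
      have "(\<lambda>n. of_nat n ^ j * (q ^ m) ^ n) summable_on {1..}"
        by (rule summable_on_SigmaD1[OF s]) (use that in auto)
      then have "((\<lambda>n. of_nat n ^ j * (q ^ m) ^ n) has_sum infsum (\<lambda>n. of_nat n ^ j * (q ^ m) ^ n) {1..}) {1..}"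
        by simp
      then have "((\<lambda>n. of_nat n ^ j * (q ^ m) ^ n) has_sum infsum (\<lambda>n. of_nat n ^ j * (q ^ m) ^ n) {1..}) UNIV"
        by (rule has_sum_cong_neutral[THEN iffD1, rotated -1]) (use assms(2) in \<open>auto simp: not_le\<close>)
      from has_sum_imp_sums[OF this] show ?thesis by (simp add: sums_iff)
    qed
    let ?I = "\<lambda>m. infsum (\<lambda>n. of_nat n ^ j * (q ^ m) ^ n) {1..}"
    have "infsum ?g ({1..} \<times> {1..}) = infsum ?I {1..}"
      by (subst infsum_Sigma_banach[OF s, symmetric]) simp
    moreover have "?I summable_on {1..}" using summable_on_Sigma_banach[OF s] by simp
    ultimately have "(?I has_sum infsum ?g ({1..} \<times> {1..})) (range Suc)" unfolding S by simp
    then have "((\<lambda>m. ?I (Suc m)) has_sum infsum ?g ({1..} \<times> {1..})) UNIV"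
      by (subst (asm) has_sum_reindex) (auto simp: o_def)
    moreover have "?I (Suc m) = (\<Sum>n. of_nat n ^ j * (q ^ Suc m) ^ n)" for m by (rule inner) simp
    ultimately show ?thesis using has_sum_imp_sums by (simp only:)
  qed
  ultimately show thesis using that by blast
qed

section \<open>Modularity of the Eisenstein series of level one\<close>

lemma divisor_sigma_of_nat:
  assumes "n > 0"
  shows "divisor_sigma j (of_nat n) = (\<Sum>d | d dvd n. d ^ j)"
proof -
  have "(THE m. (of_nat n :: rat) = of_nat m) = n" by auto
  then show ?thesis using assms by (auto simp: divisor_sigma_def)
qed

definition eisenstein_E_coeff :: "nat \<Rightarrow> nat \<Rightarrow> complex" where
  "eisenstein_E_coeff k n = (if n = 0 then 1 else
     - of_nat (4 * k) / of_real (bernoulli_number (2 * k)) * of_nat (divisor_sigma (2 * k - 1) (of_nat n)))"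

lemma eisenstein_E_fourier:
  assumes "k > 0"
  shows "has_fourier_expansion 1 (eisenstein_E k) (eisenstein_E_coeff k)"
  unfolding has_fourier_expansion_def
proof
  fix z assume z: "z \<in> upper_half_plane"
  let ?q = "exp (2 * of_real pi * \<i> * z)" and ?c = "of_nat (4 * k) / of_real (bernoulli_number (2 * k)) :: complex"
  let ?s = "\<lambda>n. of_nat (divisor_sigma (2 * k - 1) (of_nat (Suc n))) * ?q ^ Suc n"
  have "2 * k - 1 > 0" using assms by simp
  from lambert_series[OF norm_q_less_1[OF z] this] obtain L
    where "(\<lambda>N. of_nat (\<Sum>d | d dvd Suc N. d ^ (2 * k - 1)) * ?q ^ Suc N) sums L" by blast
  then have "summable ?s"
    by (simp add: divisor_sigma_of_nat sums_iff del: of_nat_Suc power_Suc of_nat_sum)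
  then have "(\<lambda>n. - ?c * ?s n) sums (- ?c * (\<Sum>n. ?s n))" by (intro sums_mult summable_sums)
  also have "(\<lambda>n. - ?c * ?s n) = (\<lambda>n. eisenstein_E_coeff k (Suc n) * ?q ^ Suc n)"
    by (simp add: eisenstein_E_coeff_def mult.assoc del: of_nat_Suc power_Suc)
  finally have "(\<lambda>n. eisenstein_E_coeff k n * ?q ^ n) sums (- ?c * (\<Sum>n. ?s n) + eisenstein_E_coeff k 0 * ?q ^ 0)"
    by (rule sums_Suc)
  also have "- ?c * (\<Sum>n. ?s n) + eisenstein_E_coeff k 0 * ?q ^ 0 = eisenstein_E k z"
    by (simp add: eisenstein_E_def eisenstein_E_coeff_def)
  also have "(\<lambda>n. eisenstein_E_coeff k n * ?q ^ n)
      = (\<lambda>n. eisenstein_E_coeff k n * exp (2 * of_real pi * \<i> * of_nat n * z / of_real 1))"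
    by (simp add: mult_ac flip: exp_of_nat_mult)
  finally show "(\<lambda>n. eisenstein_E_coeff k n * exp (2 * of_real pi * \<i> * of_nat n * z / of_real 1)) sums eisenstein_E k z" .
qed

text \<open>
  Apply the Lipschitz formula to each row of the lattice sum and collect the result as a Lambert
  series. Euler's formula turns the factor \<open>(2 \<pi> i)\<^sup>2\<^sup>k / ((2k - 1)! \<zeta>(2k))\<close> into \<open>-4k / B\<^sub>2\<^sub>k\<close>.
\<close>
lemma lattice_sum_eq_eisenstein_E:
  assumes "k > 1" "z \<in> upper_half_plane"
  shows "lattice_sum (2 * k) z = 2 * zeta_sum (2 * k) * eisenstein_E k z"
proof -
  let ?w = "2 * k"
  let ?q = "exp (2 * of_real pi * \<i> * z)"
  define c :: complex where "c = (2 * of_real pi * \<i>) ^ ?w / fact (?w - 1)"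
  define B :: complex where "B = of_real (bernoulli_number ?w)"
  have "?w - 1 > 0" using assms by simp
  from lambert_series[OF norm_q_less_1[OF assms(2)] this] obtain L
    where L1: "(\<lambda>N. of_nat (\<Sum>d | d dvd Suc N. d ^ (?w - 1)) * ?q ^ Suc N) sums L"
      and L2: "(\<lambda>m. \<Sum>n. of_nat n ^ (?w - 1) * (?q ^ Suc m) ^ n) sums L" by blast
  define L' where "L' m = (\<Sum>n. of_nat n ^ (?w - 1) * (?q ^ Suc m) ^ n)" for m
  have w: "?w \<ge> 4" using assms by simp
  have row: "infsum (\<lambda>n::int. 1 / (of_nat (Suc m) * z + of_int n) ^ ?w) UNIV = c * L' m" for m
  proof -
    have "of_nat (Suc m) * z \<in> upper_half_plane" using assms(2) by (simp add: upper_half_plane_def add_pos_nonneg)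
    moreover have "exp (2 * of_real pi * \<i> * (of_nat (Suc m) * z)) = ?q ^ Suc m"
      by (simp add: mult_ac del: of_nat_Suc power_Suc flip: exp_of_nat_mult)
    ultimately show ?thesis using lipschitz_formula[of "of_nat (Suc m) * z" ?w] w
      by (simp add: c_def L'_def del: of_nat_Suc power_Suc)
  qed
  have "lattice_sum ?w z = 2 * zeta_sum ?w + 2 * (\<Sum>m. c * L' m)"
    using lattice_sum_rows[OF assms(2) w] by (simp only: row) simp
  also have "(\<Sum>m. c * L' m) = c * L"
    using L2 by (simp add: L'_def[abs_def] sums_iff suminf_mult)
  finally have G: "lattice_sum ?w z = 2 * zeta_sum ?w + 2 * c * L" by simp
  have L: "(\<Sum>n. of_nat (divisor_sigma (?w - 1) (of_nat (Suc n))) * ?q ^ Suc n) = L"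
    using L1 by (simp add: divisor_sigma_of_nat sums_iff del: of_nat_Suc power_Suc of_nat_sum)
  have E: "eisenstein_E k z = 1 - of_nat (4 * k) / B * L"
    unfolding eisenstein_E_def L B_def ..
  have "fact ?w = (of_nat ?w :: complex) * fact (?w - 1)"
    using assms(1) by (subst fact_reduce) auto
  then have zeta: "2 * zeta_sum ?w * of_nat ?w = - (c * B)"
    using assms(1) unfolding c_def B_def zeta_even_bernoulli[of ?w, simplified]
    by (subst zeta_even_bernoulli) (auto simp: field_simps)
  moreover have "zeta_sum ?w \<noteq> 0" using w by (intro zeta_sum_nonzero) auto
  ultimately have "B \<noteq> 0" using assms(1) by auto
  have "2 * zeta_sum ?w * (of_nat (4 * k) / B * L) = 2 * (2 * zeta_sum ?w * of_nat ?w) / B * L" by simp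
  also have "\<dots> = - (2 * c * L)" unfolding zeta using \<open>B \<noteq> 0\<close> by simp
  finally show ?thesis unfolding G E by (simp add: right_diff_distrib)
qed

text \<open>
  The matrix permutes the nonzero integer row vectors \<open>(m, n)\<close>.
\<close>
lemma lattice_sum_modular:
  assumes "A \<in> SL2Z" "z \<in> upper_half_plane"
  shows "slash w (lattice_sum w) A z = lattice_sum w z"
proof -
  obtain a b c d where A: "A = (a, b, c, d)" by (metis prod_cases4)
  then have det: "a * d - b * c = 1" using assms(1) by (simp add: SL2Z_def)
  define u v where "u = of_int a * z + of_int b" and "v = of_int c * z + of_int d"
  have v: "v \<noteq> 0" using SL2Z_denominator_nonzero assms A by (simp add: v_def)
  have "slash w (lattice_sum w) A z
      = (\<Sum>\<^sub>\<infinity>p\<in>UNIV - {(0, 0)}. (case p of (m, n) \<Rightarrow> 1 / (of_int m * (u / v) + of_int n) ^ w) * (1 / v ^ w))"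
    unfolding infsum_cmult_left' by (simp add: slash_def A lattice_sum_def u_def v_def)
  also have "\<dots> = (\<Sum>\<^sub>\<infinity>(m, n)\<in>UNIV - {(0, 0)}. 1 / (of_int (m * a + n * c) * z + of_int (m * b + n * d)) ^ w)"
  proof (rule infsum_cong)
    fix p :: "int \<times> int"
    obtain m n where p: "p = (m, n)" by (cases p)
    have "(of_int m * (u / v) + of_int n) * v = of_int (m * a + n * c) * z + of_int (m * b + n * d)"
      using v by (simp add: distrib_right) (simp add: u_def v_def algebra_simps)
    then have "1 / (of_int m * (u / v) + of_int n) ^ w * (1 / v ^ w)
        = 1 / (of_int (m * a + n * c) * z + of_int (m * b + n * d)) ^ w"
      by (metis mult_1 power_mult_distrib times_divide_times_eq)
    then show "(case p of (m, n) \<Rightarrow> 1 / (of_int m * (u / v) + of_int n) ^ w) * (1 / v ^ w)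
        = (case p of (m, n) \<Rightarrow> 1 / (of_int (m * a + n * c) * z + of_int (m * b + n * d)) ^ w)"
      unfolding p split .
  qed
  also have "\<dots> = lattice_sum w z"
    unfolding lattice_sum_def
  proof -
    define F G :: "int \<times> int \<Rightarrow> int \<times> int"
      where "F = (\<lambda>(m, n). (m * a + n * c, m * b + n * d))" and "G = (\<lambda>(m, n). (m * d - n * c, n * a - m * b))"
    have GF: "G (F p) = p" and FG: "F (G p) = p" for p
    proof -
      obtain m n where p: "p = (m, n)" by (cases p)
      have *: "(m * a + n * c) * d - (m * b + n * d) * c = m * (a * d - b * c)"
        "(m * b + n * d) * a - (m * a + n * c) * b = n * (a * d - b * c)"
        "(m * d - n * c) * a + (n * a - m * b) * c = m * (a * d - b * c)"
        "(m * d - n * c) * b + (n * a - m * b) * d = n * (a * d - b * c)"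
        by (simp_all add: algebra_simps)
      show "G (F p) = p" "F (G p) = p"
        unfolding p F_def G_def split * det by simp_all
    qed
    have "F (0, 0) = (0, 0)" "G (0, 0) = (0, 0)" by (simp_all add: F_def G_def)
    then have "F p \<noteq> (0, 0) \<longleftrightarrow> p \<noteq> (0, 0)" "G p \<noteq> (0, 0) \<longleftrightarrow> p \<noteq> (0, 0)" for p
      using GF FG by metis+
    then show "(\<Sum>\<^sub>\<infinity>(m, n)\<in>UNIV - {(0, 0)}. 1 / (of_int (m * a + n * c) * z + of_int (m * b + n * d)) ^ w)
      = (\<Sum>\<^sub>\<infinity>(m, n)\<in>UNIV - {(0, 0)}. 1 / (of_int m * z + of_int n) ^ w)"
      by (intro infsum_reindex_bij_witness[of _ G F]) (auto simp: GF FG, auto simp: F_def)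
  qed
  finally show ?thesis .
qed

lemma eisenstein_E_modular:
  assumes "k > 1" "A \<in> SL2Z" "z \<in> upper_half_plane"
  shows "slash (2 * k) (eisenstein_E k) A z = eisenstein_E k z"
proof -
  have nz: "2 * zeta_sum (2 * k) \<noteq> 0" using assms(1) zeta_sum_nonzero[of "2 * k"] by simp
  have "slash (2 * k) (\<lambda>z. \<Sum>i\<in>{()}. 2 * zeta_sum (2 * k) * eisenstein_E k z) A z = slash (2 * k) (lattice_sum (2 * k)) A z"
    by (rule slash_cong) (use assms lattice_sum_eq_eisenstein_E in auto)
  then have "2 * zeta_sum (2 * k) * slash (2 * k) (eisenstein_E k) A z = 2 * zeta_sum (2 * k) * eisenstein_E k z"
    unfolding slash_sum_scaled using lattice_sum_modular[OF assms(2,3)] lattice_sum_eq_eisenstein_E[OF assms(1,3)] by simp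
  with nz show ?thesis by simp
qed

lemma eisenstein_E_translate:
  assumes "k > 1" "z \<in> upper_half_plane"
  shows "eisenstein_E k (z + of_int b) = eisenstein_E k z"
  using eisenstein_E_modular[OF assms(1) _ assms(2), of "(1, b, 0, 1)"] by (simp add: SL2Z_def slash_def)

text \<open>
  The matrix \<open>(d a, d b, c, e)\<close> of \<open>z \<mapsto> d A z\<close> factors as a matrix in \<open>SL2Z\<close> times an upper triangular
  matrix \<open>(\<alpha>, \<beta>, 0, d / \<alpha>)\<close>, where \<open>\<alpha> = gcd(d a, c) = gcd(d, c)\<close>. The first factor leaves \<open>E\<close> invariant,
  so only the triangular one remains; its effect on Fourier expansions is plain.
\<close>
lemma slash_eisenstein_E_scaled:
  assumes "k > 1" "d > 0" "(a, b, c, e) \<in> SL2Z"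
  obtains be where "\<And>z. z \<in> upper_half_plane \<Longrightarrow> slash (2 * k) (\<lambda>z. eisenstein_E k (of_nat d * z)) (a, b, c, e) z
      = (of_nat (gcd d (nat \<bar>c\<bar>)) / of_nat d) ^ (2 * k)
        * eisenstein_E k ((of_nat (gcd d (nat \<bar>c\<bar>)) * z + of_int be) / of_nat (d div gcd d (nat \<bar>c\<bar>)))"
proof -
  define al where "al = gcd d (nat \<bar>c\<bar>)"
  define de where "de = d div al"
  have "al dvd d" unfolding al_def by (rule gcd_dvd1)
  then have d: "d = al * de" by (simp add: de_def)
  then have pos: "al > 0" "de > 0" using assms(2) by (auto intro!: Nat.gr0I)
  have al: "int al = gcd (int d) c" by (simp add: al_def flip: gcd_int_int_eq)
  obtain r where r: "c = int al * r" using al by (metis dvdE gcd_dvd2)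
  have cop_ac: "coprime a c"
  proof (rule coprimeI)
    fix x assume "x dvd a" "x dvd c"
    then have "x dvd a * e - b * c" by (intro dvd_diff) auto
    then show "is_unit x" using assms(3) by (simp add: SL2Z_def)
  qed
  have "coprime (int de) r"
  proof -
    have "int de = int d div gcd (int d) c" unfolding al[symmetric] using pos by (simp add: d)
    moreover have "r = c div gcd (int d) c" unfolding al[symmetric] using pos r by simp
    ultimately show ?thesis using assms(2) by (simp add: div_gcd_coprime)
  qed
  moreover have "coprime a r" using cop_ac r by simp
  ultimately have "coprime (int de * a) r" by simp
  then obtain s q' where "s * (int de * a) + q' * r = 1" by (metis bezout_int coprime_imp_gcd_eq_1)
  then obtain q where sq: "int de * a * s - q * r = 1" by (metis mult.commute mult_minus_left diff_minus_eq_add)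
  \<comment> \<open>The first column of \<open>(d a, d b, c, e)\<close> is \<open>al\<close> times the primitive column \<open>(p, r)\<close>, which is completed
    to \<open>(p, q, r, s)\<close> in \<open>SL2Z\<close>; applying the inverse of that matrix to the second column gives \<open>(be, de)\<close>.\<close>
  define p where "p = int de * a"
  define be where "be = s * int d * b - q * e"
  have A': "(p, q, r, s) \<in> SL2Z" using sq by (simp add: SL2Z_def p_def)
  have det: "a * e - b * c = 1" using assms(3) by (simp add: SL2Z_def)
  have e1: "p * int al = int d * a" by (simp add: p_def d)
  have e2: "p * be + q * int de = int d * b"
  proof -
    have d': "int d = int al * int de" by (simp add: d)
    show ?thesis unfolding p_def be_def using sq det r d' by algebra
  qed
  have e3: "r * be + s * int de = e"
  proof -
    have d': "int d = int al * int de" by (simp add: d)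
    show ?thesis unfolding be_def using sq det r d' by algebra
  qed
  have "slash (2 * k) (\<lambda>z. eisenstein_E k (of_nat d * z)) (a, b, c, e) z
      = (of_nat al / of_nat d) ^ (2 * k) * eisenstein_E k ((of_nat al * z + of_int be) / of_nat de)"
    if z: "z \<in> upper_half_plane" for z
  proof -
    define y where "y = (of_nat al * z + of_int be) / of_nat de"
    define v where "v = of_int c * z + of_int e"
    have v: "v \<noteq> 0" using SL2Z_denominator_nonzero[OF assms(3) z] by (simp add: v_def)
    have y: "y \<in> upper_half_plane"
      using z pos by (simp add: y_def upper_half_plane_def Im_divide_of_nat)
    have num: "of_int p * y + of_int q = of_nat d * (of_int a * z + of_int b) / of_nat de"
    proof -
      have "of_int p * y + of_int q = (of_int (p * int al) * z + of_int (p * be + q * int de)) / of_nat de"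
        using pos by (simp add: y_def field_simps)
      then show ?thesis unfolding e1 e2 by (simp add: algebra_simps)
    qed
    have den: "of_int r * y + of_int s = v / of_nat de"
    proof -
      have "of_int r * y + of_int s = (of_int (int al * r) * z + of_int (r * be + s * int de)) / of_nat de"
        using pos by (simp add: y_def field_simps)
      then show ?thesis unfolding r[symmetric] e3 v_def .
    qed
    have "eisenstein_E k y = slash (2 * k) (eisenstein_E k) (p, q, r, s) y"
      using eisenstein_E_modular[OF assms(1) A' y] by simp
    also have "\<dots> = eisenstein_E k (of_nat d * ((of_int a * z + of_int b) / v)) / (v / of_nat de) ^ (2 * k)"
      using pos v unfolding slash_def split num den by simp
    finally have "eisenstein_E k (of_nat d * ((of_int a * z + of_int b) / v)) / v ^ (2 * k)
      = eisenstein_E k y * (1 / of_nat de) ^ (2 * k)"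
      using v pos by (simp add: power_divide field_simps)
    moreover have "1 / of_nat de = (of_nat al / of_nat d :: complex)" using pos by (simp add: d)
    ultimately show ?thesis by (simp add: slash_def v_def y_def)
  qed
  then show thesis using that unfolding al_def de_def by blast
qed

section \<open>Inverting the matrix of constant terms\<close>

text \<open>
  A divisor of a squarefree number is determined by the set of primes dividing it. The product runs
  over all primes of \<open>N\<close>, so that products attached to different divisors can be multiplied factor
  by factor.
\<close>
lemma squarefree_divisor_eq_prod:
  fixes N :: nat
  assumes "squarefree N" "d dvd N"
  shows "(\<Prod>p\<in>prime_factors N. if p dvd d then p else 1) = d"
proof -
  have "N \<noteq> 0" using assms(1) not_squarefree_0 by metis
  then have "d \<noteq> 0" using assms(2) by auto
  have sq: "squarefree d" using assms squarefree_mono by blast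
  have "(\<Prod>p\<in>prime_factors N. if p dvd d then p else 1) = (\<Prod>p\<in>prime_factors d. p)"
    using \<open>d \<noteq> 0\<close> \<open>N \<noteq> 0\<close> assms(2)
    by (intro prod.mono_neutral_cong_right) (auto simp: prime_factors_dvd)
  also have "\<dots> = (\<Prod>p\<in>prime_factors d. p ^ multiplicity p d)"
    using sq \<open>d \<noteq> 0\<close> by (intro prod.cong) (auto simp: squarefree_factorial_semiring')
  also have "\<dots> = d" using prod_prime_factors[OF \<open>d \<noteq> 0\<close>] by simp
  finally show ?thesis .
qed

text \<open>
  The divisors of \<open>N\<close> correspond to the subsets of its set of primes, and the sum is the expanded
  form of the product on the right.
\<close>
lemma sum_divisors_squarefree:
  fixes N :: nat and g h :: "nat \<Rightarrow> 'a::comm_semiring_1"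
  assumes "squarefree N"
  shows "(\<Sum>d | d dvd N. \<Prod>p\<in>prime_factors N. if p dvd d then g p else h p) = (\<Prod>p\<in>prime_factors N. g p + h p)"
proof -
  let ?P = "prime_factors N"
  have "N \<noteq> 0" using assms not_squarefree_0 by metis
  have prime_dvd_prod: "q dvd \<Prod>X \<longleftrightarrow> q \<in> X" if "X \<subseteq> ?P" "q \<in> ?P" for X q
  proof -
    have "finite X" using that by (meson finite_set_mset finite_subset)
    moreover have "prime q" "\<And>p. p \<in> X \<Longrightarrow> prime p" using that by (auto simp: prime_factors_dvd)
    ultimately have "q dvd \<Prod>X \<longleftrightarrow> (\<exists>p\<in>X. q dvd p)" by (simp add: prime_dvd_prod_iff)
    also have "\<dots> \<longleftrightarrow> q \<in> X"
    proof
      assume "\<exists>p\<in>X. q dvd p"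
      then obtain p where p: "p \<in> X" "q dvd p" by blast
      then have "q = p" using \<open>prime q\<close> \<open>\<And>p. p \<in> X \<Longrightarrow> prime p\<close> by (intro primes_dvd_imp_eq) auto
      with p(1) show "q \<in> X" by simp
    qed (use dvd_refl in blast)
    finally show ?thesis .
  qed
  have "(\<Sum>d | d dvd N. \<Prod>p\<in>?P. if p dvd d then g p else h p) = (\<Sum>X\<in>Pow ?P. (\<Prod>p\<in>X. g p) * (\<Prod>p\<in>?P - X. h p))"
  proof (rule sum.reindex_bij_witness[of _ "\<lambda>X. \<Prod>X" "\<lambda>d. {p \<in> ?P. p dvd d}"])
    fix d assume "d \<in> {d. d dvd N}"
    then have d: "d dvd N" by simp
    show "\<Prod>{p \<in> ?P. p dvd d} = d"
      using squarefree_divisor_eq_prod[OF assms d] by (simp add: prod.If_cases Int_def)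
    show "(\<Prod>p\<in>{p \<in> ?P. p dvd d}. g p) * (\<Prod>p\<in>?P - {p \<in> ?P. p dvd d}. h p) = (\<Prod>p\<in>?P. if p dvd d then g p else h p)"
      by (subst prod.If_cases) (auto intro!: arg_cong2[where f="(*)"] prod.cong)
  next
    fix X assume X: "X \<in> Pow ?P"
    then show "{p \<in> ?P. p dvd \<Prod>X} = X" using prime_dvd_prod by auto
    have "\<Prod>X dvd \<Prod>?P" using X by (intro prod_dvd_prod_subset) auto
    also have "\<Prod>?P = (\<Prod>p\<in>?P. if p dvd N then p else 1)" by (intro prod.cong) auto
    also have "\<dots> = N" using assms by (intro squarefree_divisor_eq_prod) auto
    finally show "\<Prod>X \<in> {d. d dvd N}" by simp
  qed auto
  then show ?thesis by (simp add: prod_add)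
qed

text \<open>
  The coefficient of \<open>[0]\<^sub>c f\<close> in \<open>eisenstein_part_coeff N k f d\<close>, for \<open>w = 2 k\<close>.
\<close>
definition cusp_weight :: "nat \<Rightarrow> nat \<Rightarrow> nat \<Rightarrow> nat \<Rightarrow> complex" where
  "cusp_weight w N c d = (- 1) ^ (omega d + omega c) / (\<Prod>p\<in>prime_factors N. of_nat p ^ w - 1)
        * (of_nat (N * gcd c d) / of_nat c) ^ w"

text \<open>
  The dilate \<open>E(d z)\<close> has constant term \<open>(gcd(d, c) / d)\<^sup>w\<close> at the cusp \<open>1/c\<close>; the weights form the
  inverse of this matrix. Both matrices are tensor products over the primes \<open>p\<close> of \<open>N\<close>, so the
  sum over \<open>d\<close> splits into a product of local factors. With rows and columns indexed by \<open>1, p\<close>, the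
  local statement is that the rows \<open>(P, -P) / (P - 1)\<close> and \<open>(-1, P) / (P - 1)\<close>, where
  \<open>P = p\<^sup>w\<close>, form the inverse of the matrix with rows \<open>(1, 1)\<close> and \<open>(1 / P, 1)\<close>.
\<close>
lemma cusp_weight_inverse:
  assumes "squarefree N" "w > 0" "c dvd N" "c' dvd N"
  shows "(\<Sum>d | d dvd N. cusp_weight w N c d * (of_nat (gcd d c') / of_nat d) ^ w) = (if c = c' then 1 else 0)"
proof -
  let ?P = "prime_factors N"
  have "N \<noteq> 0" using assms(1) not_squarefree_0 by metis
  let ?e = "\<lambda>d p. if p dvd d then of_nat p else 1 :: complex"
  let ?s = "\<lambda>d p. if p dvd d then - 1 else 1 :: complex"
  have e: "of_nat d = (\<Prod>p\<in>?P. ?e d p)" if "d dvd N" for d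
  proof -
    have "of_nat d = (of_nat (\<Prod>p\<in>?P. if p dvd d then p else 1) :: complex)"
      by (subst squarefree_divisor_eq_prod[OF assms(1) that]) simp
    then show ?thesis by (simp add: of_nat_prod if_distrib cong: if_cong)
  qed
  have s: "(- 1) ^ omega d = (\<Prod>p\<in>?P. ?s d p)" if "d dvd N" for d
  proof -
    have "prime_factors d = {p \<in> ?P. p dvd d}" using that \<open>N \<noteq> 0\<close> by (auto simp: prime_factors_dvd)
    then show ?thesis by (simp add: omega_def prod.If_cases Int_def)
  qed
  let ?t = "\<lambda>c' c p. if p dvd c \<and> p dvd c' then of_nat p else 1 :: complex"
  let ?F = "\<lambda>d p. ?s d p * ?s c p / (of_nat p ^ w - 1) * (of_nat p * ?t d c p / ?e c p) ^ w * (?t c' d p / ?e d p) ^ w"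
  have "cusp_weight w N c d * (of_nat (gcd d c') / of_nat d) ^ w = (\<Prod>p\<in>?P. ?F d p)" if d: "d dvd N" for d
  proof -
    have g: "of_nat (gcd a b) = (\<Prod>p\<in>?P. ?t b a p)" if "a dvd N" for a b
      using e[of "gcd a b"] that by (simp add: dvd_trans[OF gcd_dvd1])
    have N: "of_nat N = (\<Prod>p\<in>?P. of_nat p :: complex)"
      unfolding e[OF dvd_refl] by (intro prod.cong) auto
    show ?thesis
      unfolding cusp_weight_def power_add s[OF d] s[OF assms(3)] of_nat_mult g[OF assms(3)] g[OF d] N e[OF d] e[OF assms(3)]
      by (simp only: prod.distrib prod_dividef prod_power_distrib[symmetric])
  qed
  then have "(\<Sum>d | d dvd N. cusp_weight w N c d * (of_nat (gcd d c') / of_nat d) ^ w) = (\<Sum>d | d dvd N. \<Prod>p\<in>?P. ?F d p)"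
    by (intro sum.cong) auto
  also have "\<dots> = (\<Sum>d | d dvd N. \<Prod>p\<in>?P. if p dvd d then ?F N p else ?F 1 p)"
    by (intro sum.cong prod.cong refl) (auto simp: prime_factors_dvd)
  also have "\<dots> = (\<Prod>p\<in>?P. ?F N p + ?F 1 p)"
    by (rule sum_divisors_squarefree[OF assms(1)])
  also have "\<dots> = (\<Prod>p\<in>?P. if p dvd c \<longleftrightarrow> p dvd c' then 1 else 0)"
  proof (rule prod.cong[OF refl])
    fix p assume "p \<in> ?P"
    then have p: "prime p" "p dvd N" by (auto simp: prime_factors_dvd)
    then have "p > 1" using prime_gt_1_nat by blast
    then have "p ^ w > 1" using one_less_power[OF _ assms(2)] by blast
    then have "of_nat p ^ w \<noteq> (1 :: complex)" by (metis less_irrefl of_nat_1 of_nat_eq_iff of_nat_power)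
    moreover from this have "1 + of_nat p ^ w * of_nat p ^ w \<noteq> (2 * of_nat p ^ w :: complex)"
    proof -
      have "(of_nat p ^ w - 1) * (of_nat p ^ w - 1) \<noteq> (0 :: complex)"
        using \<open>of_nat p ^ w \<noteq> 1\<close> by simp
      then show ?thesis by (simp add: algebra_simps)
    qed
    moreover have "\<not> p dvd 1" using p by auto
    moreover have "of_nat p \<noteq> (0 :: complex)" using \<open>p > 1\<close> by simp
    ultimately show "?F N p + ?F 1 p = (if p dvd c \<longleftrightarrow> p dvd c' then 1 else 0)"
      using p by (cases "p dvd c"; cases "p dvd c'") (simp_all add: power_divide power_mult_distrib field_simps)
  qed
  also have "\<dots> = (if c = c' then 1 else 0)"
  proof (cases "c = c'")
    case False
    have "\<exists>p\<in>?P. \<not> (p dvd c \<longleftrightarrow> p dvd c')"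
    proof (rule ccontr)
      assume "\<not> ?thesis"
      then have "(\<Prod>p\<in>?P. if p dvd c then p else 1) = (\<Prod>p\<in>?P. if p dvd c' then p else 1)"
        by (intro prod.cong) auto
      with False show False using squarefree_divisor_eq_prod[OF assms(1)] assms(3,4) by simp
    qed
    then show ?thesis using False by (auto intro!: prod_zero)
  qed auto
  finally show ?thesis .
qed

section \<open>Cusps of Gamma0(N) for squarefree N\<close>

text \<open>
  A common divisor \<open>x\<close> of \<open>c\<close> and of the cofactor would also divide the gcd, so \<open>x\<^sup>2\<close> would divide
  \<open>N\<close>. This is where squarefreeness enters the study of cusps.
\<close>
lemma coprime_cofactor_of_gcd:
  fixes N :: nat and c :: int
  assumes "squarefree N"
  shows "coprime c (int N div gcd c (int N))"
proof (rule coprimeI)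
  define g where "g = gcd c (int N)"
  define M where "M = int N div g"
  have N: "int N = g * M" unfolding M_def g_def by simp
  fix x assume x: "x dvd c" "x dvd int N div gcd c (int N)"
  then have "x dvd M" by (simp add: M_def g_def)
  moreover from this N have "x dvd int N" by simp
  then have "x dvd g" using x(1) unfolding g_def by simp
  ultimately have "x * x dvd int N" unfolding N by (intro mult_dvd_mono)
  then have "int (nat \<bar>x\<bar> ^ 2) dvd int N" by (simp add: power2_eq_square)
  then have "(nat \<bar>x\<bar>)\<^sup>2 dvd N" by (simp only: int_dvd_int_iff)
  then have "nat \<bar>x\<bar> dvd 1" using assms squarefreeD by blast
  then show "is_unit x" by simp
qed

lemma exists_linear_congruence:
  fixes a M b :: int
  assumes "coprime a M"
  obtains j where "M dvd a * j + b"
proof -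
  obtain u v where "u * a + v * M = 1" using assms by (metis bezout_int coprime_imp_gcd_eq_1)
  then have "a * (- b * u) + b = M * (v * b)" by algebra
  then show thesis using that by (metis dvd_triv_left)
qed

text \<open>
  Take \<open>c\<close> to be the gcd of \<open>N\<close> with the lower left entry of \<open>A\<close>; that entry is coprime to \<open>N / c\<close> since \<open>N\<close> is
  squarefree. The condition that the quotient of \<open>A\<close> by \<open>(1, 0, c, 1)\<close> times a translation by \<open>j\<close>
  lies in \<open>Gamma0 N\<close> becomes a linear congruence for \<open>j\<close> modulo \<open>N / c\<close> in which that entry is the
  leading coefficient. In other words, the fractions \<open>1/c\<close> with \<open>c dvd N\<close> represent all cusps.
\<close>
lemma SL2Z_cusp_representative:
  assumes "squarefree N" "A \<in> SL2Z"
  obtains c j g where "c dvd N" "g \<in> Gamma0 N" "A = mat_mul g (mat_mul (1, 0, int c, 1) (1, j, 0, 1))"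
proof -
  obtain a b c e where A: "A = (a, b, c, e)" by (metis prod_cases4)
  have "N \<noteq> 0" using assms not_squarefree_0 by metis
  define c0 where "c0 = nat (gcd c (int N))"
  have c0: "int c0 = gcd c (int N)" by (simp add: c0_def)
  have dvd: "c0 dvd N" by (metis c0 gcd_dvd2 int_dvd_int_iff)
  then obtain M where M: "N = c0 * M" by blast
  have "c0 > 0" using \<open>N \<noteq> 0\<close> M by (auto intro!: Nat.gr0I)
  obtain r where r: "c = int c0 * r" by (metis c0 dvdE gcd_dvd1)
  have "int N div gcd c (int N) = int M" using \<open>c0 > 0\<close> unfolding c0[symmetric] by (simp add: M)
  then have "coprime c (int M)" using coprime_cofactor_of_gcd[OF assms(1), of c] by simp
  then obtain j where j: "int M dvd c * j + (r - e)" using exists_linear_congruence by blast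
  \<comment> \<open>The second factor is the inverse of \<open>(1, 0, c0, 1) (1, j, 0, 1)\<close>.\<close>
  define g where "g = mat_mul A (int c0 * j + 1, - j, - int c0, 1)"
  have "g \<in> SL2Z" unfolding g_def by (rule mat_mul_SL2Z[OF assms(2)]) (simp add: SL2Z_def)
  moreover have "int N dvd c * (int c0 * j + 1) + e * (- int c0)"
  proof -
    have "c * (int c0 * j + 1) + e * (- int c0) = int c0 * (c * j + (r - e))"
      by (simp add: r algebra_simps)
    then show ?thesis using j by (simp add: M mult_dvd_mono)
  qed
  ultimately have "g \<in> Gamma0 N" by (simp add: Gamma0_def g_def mat_mul_def A)
  moreover have "A = mat_mul g (mat_mul (1, 0, int c0, 1) (1, j, 0, 1))"
    by (simp add: g_def mat_mul_def A algebra_simps)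
  ultimately show thesis using that dvd by blast
qed

text \<open>
  The width of the cusp \<open>1/c\<close> divides \<open>N / c\<close>: a conjugate of the translation by \<open>N / c\<close> has lower
  left entry \<open>- c\<^sup>2 (N / c) = - c N\<close>.
\<close>
lemma Gamma0_upper_triangular_conjugate:
  assumes "c dvd N"
  shows "\<exists>g\<in>Gamma0 N. mat_mul (1, 0, int c, 1) (1, int (N div c), 0, 1) = mat_mul g (1, 0, int c, 1)"
proof
  let ?h = "int (N div c)"
  let ?g = "(1 - int c * ?h, ?h, - (int c * (int c * ?h)), int c * ?h + 1)"
  have "int c * ?h = int (c * (N div c))" by (simp only: of_nat_mult)
  then have h: "int c * ?h = int N" using assms by simp
  have "int N dvd - (int c * (int c * ?h))" unfolding h by simp
  moreover have "?g \<in> SL2Z" by (simp add: SL2Z_def algebra_simps)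
  ultimately show "?g \<in> Gamma0 N" by (simp add: Gamma0_def)
  show "mat_mul (1, 0, int c, 1) (1, ?h, 0, 1) = mat_mul ?g (1, 0, int c, 1)"
    by (simp add: mat_mul_def algebra_simps)
qed

lemma slash_translation: "slash w f (1, b, 0, 1) z = f (z + of_int b)"
  by (simp add: slash_def)

lemma slash_Gamma0_mat_mul:
  assumes "f \<in> modular_forms w N" "g \<in> Gamma0 N" "A \<in> SL2Z" "z \<in> upper_half_plane"
  shows "slash w f (mat_mul g A) z = slash w f A z"
proof -
  have "slash w f (mat_mul g A) z = slash w (slash w f g) A z"
    using assms Gamma0_subset_SL2Z by (intro slash_mat_mul) auto
  also have "\<dots> = slash w f A z"
    using assms by (intro slash_cong) (auto simp: modular_forms_def)
  finally show ?thesis .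
qed

lemma unipotent_SL2Z: "(1, 0, c, 1) \<in> SL2Z" "(1, c, 0, 1) \<in> SL2Z"
  by (simp_all add: SL2Z_def)

lemma slash_lower_unipotent_periodic:
  assumes "f \<in> modular_forms w N" "c dvd N" "z \<in> upper_half_plane"
  shows "slash w f (1, 0, int c, 1) (z + of_nat (N div c)) = slash w f (1, 0, int c, 1) z"
proof -
  let ?B = "(1, 0, int c, 1)" and ?T = "(1, int (N div c), 0, 1)"
  obtain g where g: "g \<in> Gamma0 N" "mat_mul ?B ?T = mat_mul g ?B"
    using Gamma0_upper_triangular_conjugate[OF assms(2)] by blast
  have "slash w f ?B (z + of_nat (N div c)) = slash w (slash w f ?B) ?T z"
    unfolding slash_translation by simp
  also have "\<dots> = slash w f (mat_mul ?B ?T) z"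
    using assms(3) unipotent_SL2Z by (intro slash_mat_mul[symmetric]) auto
  also have "\<dots> = slash w f ?B z"
    unfolding g(2) using g(1) assms unipotent_SL2Z by (intro slash_Gamma0_mat_mul) auto
  finally show ?thesis .
qed

text \<open>
  The coefficients at a cusp are defined by an expansion of period \<open>N / c\<close>; they can be read off from
  any expansion of period \<open>N\<close>. In particular the constant terms agree.
\<close>
lemma coeff_at_cusp_eq:
  assumes "f \<in> modular_forms w N" "c dvd N" "N > 0"
    and a: "has_fourier_expansion (real N) (slash w f (1, 0, int c, 1)) a"
  shows "coeff_at_cusp N w c n f = a (c * n)"
proof -
  have N: "N = c * (N div c)" using assms(2) by simp
  then have pos: "c > 0" "N div c > 0" using assms(3) by (metis mult_0 mult_0_right not_gr_zero)+
  have "has_fourier_expansion (real (c * (N div c))) (slash w f (1, 0, int c, 1)) a"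
    using a N by simp
  then have "has_fourier_expansion (real (N div c)) (slash w f (1, 0, int c, 1)) (\<lambda>n. a (c * n))"
    using pos slash_lower_unipotent_periodic[OF assms(1,2)]
    by (rule has_fourier_expansion_coarsen)
  moreover have "slash w f (1, 0, int c, 1) = (\<lambda>z. f (z / (of_nat c * z + 1)) / (of_nat c * z + 1) ^ w)"
    by (simp add: slash_def fun_eq_iff)
  moreover have "real N / real c = real (N div c)" using assms(2) by (simp add: real_of_nat_div)
  ultimately show "coeff_at_cusp N w c n f = a (c * n)"
    unfolding coeff_at_cusp_def using fourier_coeff_eq pos(2) by simp
qed

lemma fourier_expansion_at_infinity:
  assumes "f \<in> modular_forms w N" "N > 0"
  shows "has_fourier_expansion 1 f (\<lambda>n. coeff_at_infinity n f)"
proof -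
  obtain a where "has_fourier_expansion (real N) (slash w f (1, 0, 0, 1)) a"
    using assms(1) unipotent_SL2Z(1)[of 0] unfolding modular_forms_def by blast
  then have "has_fourier_expansion (real (N * 1)) f a" by (simp add: slash_def)
  moreover have "f (z + of_nat 1) = f z" if "z \<in> upper_half_plane" for z
  proof -
    have "(1, 1, 0, 1) \<in> Gamma0 N" by (simp add: Gamma0_def SL2Z_def)
    then have "slash w f (1, 1, 0, 1) z = f z" using assms(1) that unfolding modular_forms_def by blast
    then show ?thesis by (simp add: slash_translation)
  qed
  ultimately have "has_fourier_expansion (real 1) f (\<lambda>n. a (N * n))"
    using assms(2) by (intro has_fourier_expansion_coarsen) auto
  then show ?thesis unfolding coeff_at_infinity_def using fourier_coeff_eq[of 1 f] by simp
qed

text \<open>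
  Up to an element of \<open>Gamma0 N\<close>, every matrix is a representative \<open>(1, 0, c, 1)\<close> followed by a
  translation, and a translation does not affect constant terms.
\<close>
lemma cusp_formI:
  assumes "squarefree N" "f \<in> modular_forms w N" "\<And>c. c dvd N \<Longrightarrow> coeff_at_cusp N w c 0 f = 0"
  shows "f \<in> cusp_forms w N"
proof -
  have "N > 0" using assms(1) by (metis gr0I not_squarefree_0)
  have "\<exists>a. has_fourier_expansion (real N) (slash w f A) a \<and> a 0 = 0" if A: "A \<in> SL2Z" for A
  proof -
    obtain c j g where cjg: "c dvd N" "g \<in> Gamma0 N" "A = mat_mul g (mat_mul (1, 0, int c, 1) (1, j, 0, 1))"
      using SL2Z_cusp_representative[OF assms(1) A] by blast
    let ?B = "(1, 0, int c, 1)" and ?T = "(1, j, 0, 1)"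
    obtain a where a: "has_fourier_expansion (real N) (slash w f ?B) a"
      using assms(2) unipotent_SL2Z(1)[of "int c"] unfolding modular_forms_def by blast
    from coeff_at_cusp_eq[OF assms(2) cjg(1) \<open>N > 0\<close> a, of 0]
    have "a 0 = 0" using assms(3)[OF cjg(1)] by simp
    have "slash w f A z = slash w f ?B (z + of_real (of_int j))" if z: "z \<in> upper_half_plane" for z
    proof -
      have "slash w f A z = slash w f (mat_mul ?B ?T) z"
        unfolding cjg(3) using assms(2) cjg(2) unipotent_SL2Z z
        by (intro slash_Gamma0_mat_mul mat_mul_SL2Z) auto
      also have "\<dots> = slash w (slash w f ?B) ?T z"
        using unipotent_SL2Z z by (intro slash_mat_mul) auto
      finally show ?thesis by (simp only: slash_translation of_real_of_int_eq)
    qed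
    then have "has_fourier_expansion (real N) (slash w f A)
      (\<lambda>n. a n * exp (2 * of_real pi * \<i> * of_nat n * of_real (of_int j) / of_real (real N)))"
      using has_fourier_expansion_translate[OF a, of "of_int j"]
      by (subst has_fourier_expansion_cong) auto
    moreover have "a 0 * exp (2 * of_real pi * \<i> * of_nat 0 * of_real (of_int j) / of_real (real N)) = 0"
      by (simp add: \<open>a 0 = 0\<close>)
    ultimately show ?thesis by blast
  qed
  then show ?thesis using assms(2) by (simp add: cusp_forms_def)
qed

section \<open>The Eisenstein series attached to the cusps\<close>

text \<open>
  For squarefree \<open>N\<close>, the primitive row vectors belonging to one cusp; \<open>g\<close> runs over the divisors of \<open>N\<close>.
\<close>
definition primitive_pairs :: "nat \<Rightarrow> nat \<Rightarrow> (int \<times> int) set" where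
  "primitive_pairs N g = {(m, n). coprime m n \<and> gcd m (int N) = int g}"

text \<open>
  Right multiplication by \<open>Gamma0 N\<close> preserves coprimality, and it multiplies the first entry by a
  unit modulo \<open>N\<close>, hence preserves the gcd of that entry with \<open>N\<close>. Conversely, complete \<open>(-c, a)\<close>
  and \<open>(m, n)\<close> to matrices in \<open>SL2Z\<close> with these bottom rows. Their quotient, with a translation by \<open>j\<close>
  inserted in between, maps the first vector to the second for every \<open>j\<close>; since \<open>N\<close> is squarefree,
  some \<open>j\<close> makes its lower left entry divisible by \<open>N\<close>.
\<close>
lemma Gamma0_orbit_eq_primitive_pairs:
  assumes "squarefree N" "coprime a c"
  shows "{(a * r - c * p, a * s - c * q) | p q r s. (p, q, r, s) \<in> Gamma0 N}
    = primitive_pairs N (nat (gcd c (int N)))"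
proof (intro equalityI subsetI)
  fix x assume "x \<in> {(a * r - c * p, a * s - c * q) | p q r s. (p, q, r, s) \<in> Gamma0 N}"
  then obtain p q r s where x: "x = (a * r - c * p, a * s - c * q)" and g: "(p, q, r, s) \<in> Gamma0 N" by blast
  have det: "p * s - q * r = 1" and r: "int N dvd r" using g by (auto simp: Gamma0_def SL2Z_def)
  have "coprime (a * r - c * p) (a * s - c * q)"
  proof (rule coprimeI)
    fix t assume t: "t dvd a * r - c * p" "t dvd a * s - c * q"
    have "(a * s - c * q) * r - (a * r - c * p) * s = c * (p * s - q * r)"
      "(a * s - c * q) * p - (a * r - c * p) * q = a * (p * s - q * r)" by (simp_all add: algebra_simps)
    then have "t dvd c" "t dvd a" using t by (metis det dvd_diff dvd_mult2 mult.right_neutral)+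
    then show "is_unit t" using assms(2) coprime_common_divisor by blast
  qed
  moreover have "gcd (a * r - c * p) (int N) = gcd c (int N)"
  proof -
    obtain t where t: "r = int N * t" using r by blast
    have cop: "coprime p (int N)"
    proof (rule coprimeI)
      fix u assume "u dvd p" "u dvd int N"
      then have "u dvd p * s - q * r" using t by (intro dvd_diff) auto
      then show "is_unit u" by (simp add: det)
    qed
    have "gcd (a * r - c * p) (int N) = gcd (- (c * p) + (a * t) * int N) (int N)"
      by (simp add: t algebra_simps)
    also have "\<dots> = gcd (c * p) (int N)"
      using gcd_add_mult[of "int N" "a * t" "- (c * p)"] by (simp add: gcd.commute add.commute)
    also have "\<dots> = gcd c (int N)"
      using cop by (metis coprime_commute gcd.commute gcd_mult_left_right_cancel)
    finally show ?thesis .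
  qed
  ultimately show "x \<in> primitive_pairs N (nat (gcd c (int N)))"
    by (simp add: x primitive_pairs_def)
next
  fix x assume "x \<in> primitive_pairs N (nat (gcd c (int N)))"
  then obtain m n where x: "x = (m, n)" and mn: "coprime m n" and gcd: "gcd m (int N) = gcd c (int N)"
    by (auto simp: primitive_pairs_def)
  obtain x0 y0 where xy: "x0 * a + y0 * c = 1" using assms(2) by (metis bezout_int coprime_imp_gcd_eq_1)
  obtain u v where "v * m + u * n = 1" using mn by (metis bezout_int coprime_imp_gcd_eq_1)
  then have uv: "u * n + v * m = 1" by simp
  have "N \<noteq> 0" using assms(1) not_squarefree_0 by metis
  define G where "G = gcd c (int N)"
  have "G > 0" using \<open>N \<noteq> 0\<close> by (simp add: G_def)
  define M where "M = int N div G"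
  have N: "int N = G * M" by (simp add: G_def M_def)
  obtain c1 where c1: "c = G * c1" by (metis G_def dvdE gcd_dvd1)
  obtain m1 where m1: "m = G * m1" by (metis G_def gcd dvdE gcd_dvd1)
  have "coprime c M" "coprime m M"
    using coprime_cofactor_of_gcd[OF assms(1), of c] coprime_cofactor_of_gcd[OF assms(1), of m]
    by (simp_all add: M_def G_def gcd)
  then have "coprime (c1 * m) M" by (simp add: c1)
  then obtain j where j: "M dvd c1 * m * j + (c1 * u + x0 * m1)" using exists_linear_congruence by blast
  \<comment> \<open>The product of the inverse of \<open>(x0, y0, -c, a)\<close>, the translation by \<open>j\<close> and \<open>(u, -v, m, n)\<close>.\<close>
  define p q r s where "p = a * (u + j * m) - y0 * m" and "q = a * (j * n - v) - y0 * n"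
    and "r = c * (u + j * m) + x0 * m" and "s = c * (j * n - v) + x0 * n"
  have "r = G * (c1 * m * j + (c1 * u + x0 * m1))" by (simp add: r_def c1 m1 algebra_simps)
  then have "int N dvd r" using j unfolding N by (simp add: mult_dvd_mono)
  moreover have "p * s - q * r = 1" unfolding p_def q_def r_def s_def using xy uv by algebra
  moreover have "a * r - c * p = m" "a * s - c * q = n"
    unfolding p_def q_def r_def s_def using xy uv by algebra+
  ultimately show "x \<in> {(a * r - c * p, a * s - c * q) | p q r s. (p, q, r, s) \<in> Gamma0 N}"
    unfolding x Gamma0_def SL2Z_def by blast
qed

definition primitive_sum :: "nat \<Rightarrow> nat \<Rightarrow> nat \<Rightarrow> complex \<Rightarrow> complex" where
  "primitive_sum w N g z = (\<Sum>\<^sub>\<infinity>(m, n)\<in>primitive_pairs N g. 1 / (of_int m * z + of_int n) ^ w)"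

lemma cusp_eisenstein_series_eq_primitive_sum:
  assumes "squarefree N" "coprime a c"
  shows "cusp_eisenstein_series w N (a, c) z = primitive_sum w N (nat (gcd c (int N))) z"
  unfolding cusp_eisenstein_series_def primitive_sum_def split Gamma0_orbit_eq_primitive_pairs[OF assms] ..

lemma zeta_multiples_sum:
  assumes "e > 0" "w \<ge> 2"
  shows "(\<Sum>\<^sub>\<infinity>t\<in>{t. t > 0 \<and> e dvd t}. 1 / of_nat t ^ w) = zeta_sum w / of_nat e ^ w"
proof -
  have "(\<Sum>\<^sub>\<infinity>t\<in>{t. t > 0 \<and> e dvd t}. 1 / of_nat t ^ w) = (\<Sum>\<^sub>\<infinity>t\<in>{1..}. 1 / of_nat t ^ w * (1 / of_nat e ^ w) :: complex)"
    by (rule infsum_reindex_bij_witness[of _ "\<lambda>t. e * t" "\<lambda>t. t div e"])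
      (use assms(1) in \<open>auto simp: Suc_le_eq power_mult_distrib dvd_div_eq_0_iff elim!: dvdE\<close>)
  also have "\<dots> = zeta_sum w / of_nat e ^ w"
    unfolding infsum_cmult_left' zeta_sum_infsum(2)[OF assms(2)] by simp
  finally show ?thesis .
qed

text \<open>
  As \<open>d dvd N\<close>, the gcd of \<open>d\<close> and \<open>m\<close> depends only on \<open>g\<close>.
\<close>
lemma dvd_mult_iff_cofactor:
  fixes t d N :: nat and m :: int
  assumes "d dvd N" "d > 0" "gcd m (int N) = int g"
  shows "int d dvd int t * m \<longleftrightarrow> d div gcd d g dvd t"
proof -
  have "gcd (int d) (int N) = int d" using assms(1) by (simp add: gcd_nat.absorb1)
  then have "gcd (int d) m = gcd (int d) (gcd (int N) m)" by (simp flip: gcd.assoc)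
  also have "\<dots> = int (gcd d g)" using assms(3) by (simp add: gcd.commute)
  finally have g: "gcd (int d) m = int (gcd d g)" .
  define h where "h = gcd d g"
  have "h > 0" using assms(2) by (simp add: h_def)
  obtain d1 where d1: "d = h * d1" by (metis dvdE gcd_dvd1 h_def)
  obtain m1 where m1: "m = int h * m1" by (metis dvdE g gcd_dvd2 h_def)
  have "coprime (int d div gcd (int d) m) (m div gcd (int d) m)"
    using assms(2) by (intro div_gcd_coprime) auto
  then have cop: "coprime (int d1) m1" unfolding g h_def[symmetric] using \<open>h > 0\<close> by (simp add: d1 m1)
  have "int d dvd int t * m \<longleftrightarrow> int h * int d1 dvd int h * (int t * m1)" by (simp add: d1 m1 mult.left_commute)
  also have "\<dots> \<longleftrightarrow> int d1 dvd int t * m1" using \<open>h > 0\<close> by simp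
  also have "\<dots> \<longleftrightarrow> int d1 dvd int t" using cop by (simp add: coprime_dvd_mult_left_iff)
  also have "\<dots> \<longleftrightarrow> d div gcd d g dvd t" using \<open>h > 0\<close> unfolding h_def[symmetric] by (simp add: d1)
  finally show ?thesis .
qed

text \<open>
  In the lattice sum at \<open>d z\<close>, every nonzero vector \<open>(d m, n)\<close> is \<open>t\<close> times a primitive vector in a unique way. If the
  primitive vector belongs to \<open>g\<close>, then \<open>t\<close> runs over the positive multiples of \<open>d / gcd(d, g)\<close>, which
  contributes the factor \<open>\<zeta>(w) (gcd(d, g) / d)\<^sup>w\<close>. This is the matrix that also describes the constant
  terms of the dilates of \<open>E\<close> at the cusps.
\<close>
lemma lattice_sum_scaled_eq_primitive_sums:
  assumes "N > 0" "d dvd N" "w \<ge> 4" "z \<in> upper_half_plane"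
  shows "lattice_sum w (of_nat d * z)
    = zeta_sum w * (\<Sum>g | g dvd N. (of_nat (gcd d g) / of_nat d) ^ w * primitive_sum w N g z)"
proof -
  let ?f = "\<lambda>(m, n). 1 / (of_int m * z + of_int n) ^ w"
  have d: "d > 0" using assms(1,2) by (auto intro!: Nat.gr0I)
  define L :: "(int \<times> int) set" where "L = {(m, n). (m, n) \<noteq> (0, 0) \<and> int d dvd m}"
  define T where "T g = {t. t > 0 \<and> d div gcd d g dvd t}" for g
  define S where "S = (SIGMA g:{g. g dvd N}. T g \<times> primitive_pairs N g)"
  define j where "j = (\<lambda>(g::nat, t::nat, m, n). (int t * m, int t * n))"
  \<comment> \<open>The inverse of \<open>j\<close>: \<open>t\<close> is the content of the vector, and \<open>g\<close> is read off from its primitive part.\<close>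
  define i where "i = (\<lambda>(m, n). (nat (gcd (m div gcd m n) (int N)), nat (gcd m n), m div gcd m n, n div gcd m n))"
  have fj: "?f (j (g, t, m, n)) = 1 / of_nat t ^ w * ?f (m, n)" for g t m n
  proof -
    have "of_int (int t * m) * z + of_int (int t * n) = of_nat t * (of_int m * z + of_int n)"
      by (simp add: algebra_simps)
    then show ?thesis by (simp only: j_def split power_mult_distrib) simp
  qed
  have fL: "?f summable_on L"
    by (rule summable_on_subset_banach[OF lattice_summable[OF assms(4,3)]]) (auto simp: L_def)
  have bij: "bij_betw j S L"
  proof (rule bij_betw_byWitness[where f' = i])
    show "\<forall>x\<in>S. i (j x) = x"
    proof
      fix x assume "x \<in> S"
      then obtain g t m n where x: "x = (g, t, m, n)" "t > 0" "coprime m n" "gcd m (int N) = int g"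
        by (auto simp: S_def T_def primitive_pairs_def)
      have "gcd (int t * m) (int t * n) = int t" using x(2,3) by (simp add: gcd_mult_left)
      then show "i (j x) = x" using x by (simp add: i_def j_def)
    qed
    have *: "i x \<in> S \<and> j (i x) = x" if "x \<in> L" for x
    proof -
      obtain m n where x: "x = (m, n)" "(m, n) \<noteq> (0, 0)" "int d dvd m" using \<open>x \<in> L\<close> by (auto simp: L_def)
      define t where "t = gcd m n"
      have "t > 0" using x(2) by (auto simp: t_def)
      obtain m1 where m: "m = t * m1" by (metis dvdE gcd_dvd1 t_def)
      obtain n1 where n: "n = t * n1" by (metis dvdE gcd_dvd2 t_def)
      have "coprime (m div gcd m n) (n div gcd m n)" using x(2) by (intro div_gcd_coprime) auto
      then have cop: "coprime m1 n1" unfolding t_def[symmetric] using \<open>t > 0\<close> by (simp add: m n)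
      have ix: "i x = (nat (gcd m1 (int N)), nat t, m1, n1)"
        unfolding i_def x(1) split t_def[symmetric] using \<open>t > 0\<close> by (simp add: m n)
      have "int d dvd int (nat t) * m1" using x(3) m \<open>t > 0\<close> by simp
      then have "d div gcd d (nat (gcd m1 (int N))) dvd nat t"
        using dvd_mult_iff_cofactor[OF assms(2) d, of m1 "nat (gcd m1 (int N))" "nat t"] by simp
      moreover have "nat (gcd m1 (int N)) dvd N" by (simp add: nat_dvd_iff)
      ultimately have "i x \<in> S" using cop \<open>t > 0\<close> by (simp add: ix S_def T_def primitive_pairs_def)
      moreover have "j (i x) = x" unfolding ix using \<open>t > 0\<close> by (simp add: j_def x(1) m n)
      ultimately show ?thesis by blast
    qed
    then show "\<forall>x\<in>L. j (i x) = x" "i ` L \<subseteq> S" by auto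
    show "j ` S \<subseteq> L"
    proof
      fix y assume "y \<in> j ` S"
      then obtain g t m n where x: "y = j (g, t, m, n)" "t > 0" "d div gcd d g dvd t" "coprime m n" "gcd m (int N) = int g"
        by (auto simp: S_def T_def primitive_pairs_def)
      have "int d dvd int t * m" using dvd_mult_iff_cofactor[OF assms(2) d x(5)] x(3) by simp
      moreover have "(m, n) \<noteq> (0, 0)" using x(4) by auto
      ultimately show "y \<in> L" using x(2) by (auto simp: x(1) j_def L_def)
    qed
  qed
  have sS: "(\<lambda>x. ?f (j x)) summable_on S"
    using fL by (subst summable_on_reindex_bij_betw[OF bij])
  have "lattice_sum w (of_nat d * z) = infsum ?f L"
    unfolding lattice_sum_def L_def
    by (rule infsum_reindex_bij_witness[of _ "\<lambda>(m, n). (m div int d, n)" "\<lambda>(m, n). (int d * m, n)"])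
      (use d in \<open>auto simp: mult_ac\<close>)
  also have "\<dots> = infsum (\<lambda>x. ?f (j x)) S"
    by (rule infsum_reindex_bij_betw[OF bij, symmetric])
  also have "\<dots> = (\<Sum>\<^sub>\<infinity>g\<in>{g. g dvd N}. \<Sum>\<^sub>\<infinity>y\<in>T g \<times> primitive_pairs N g. ?f (j (g, y)))"
    unfolding S_def by (rule infsum_Sigma_banach[symmetric]) (use sS in \<open>simp add: S_def\<close>)
  also have "\<dots> = (\<Sum>g | g dvd N. \<Sum>\<^sub>\<infinity>y\<in>T g \<times> primitive_pairs N g. ?f (j (g, y)))"
    using assms(1) by (intro infsum_finite) simp
  also have "\<dots> = (\<Sum>g | g dvd N. zeta_sum w * ((of_nat (gcd d g) / of_nat d) ^ w * primitive_sum w N g z))"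
  proof (rule sum.cong[OF refl])
    fix g assume g: "g \<in> {g. g dvd N}"
    have "(\<lambda>(g, y). ?f (j (g, y))) summable_on S" using sS by (simp add: split_def)
    then have sg: "(\<lambda>y. ?f (j (g, y))) summable_on (T g \<times> primitive_pairs N g)"
      unfolding S_def by (rule summable_on_SigmaD1) (rule g)
    have "(\<Sum>\<^sub>\<infinity>y\<in>T g \<times> primitive_pairs N g. ?f (j (g, y)))
      = (\<Sum>\<^sub>\<infinity>t\<in>T g. \<Sum>\<^sub>\<infinity>p\<in>primitive_pairs N g. ?f (j (g, t, p)))"
      by (rule infsum_Sigma_banach[OF sg, symmetric])
    also have "\<dots> = (\<Sum>\<^sub>\<infinity>t\<in>T g. 1 / of_nat t ^ w * primitive_sum w N g z)"
    proof (rule infsum_cong)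
      fix t
      have "(\<Sum>\<^sub>\<infinity>p\<in>primitive_pairs N g. ?f (j (g, t, p))) = (\<Sum>\<^sub>\<infinity>p\<in>primitive_pairs N g. 1 / of_nat t ^ w * ?f p)"
        by (rule infsum_cong) (use fj in auto)
      also have "\<dots> = 1 / of_nat t ^ w * primitive_sum w N g z"
        unfolding infsum_cmult_right' primitive_sum_def ..
      finally show "(\<Sum>\<^sub>\<infinity>p\<in>primitive_pairs N g. ?f (j (g, t, p))) = 1 / of_nat t ^ w * primitive_sum w N g z" .
    qed
    also have "\<dots> = zeta_sum w / of_nat (d div gcd d g) ^ w * primitive_sum w N g z"
      unfolding infsum_cmult_left' T_def using d assms(3)
      by (subst zeta_multiples_sum) (auto simp: div_greater_zero_iff intro: dvd_imp_le)
    also have "\<dots> = zeta_sum w * ((of_nat (gcd d g) / of_nat d) ^ w * primitive_sum w N g z)"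
    proof -
      have "of_nat (d div gcd d g) = (of_nat d / of_nat (gcd d g) :: complex)"
      proof -
        have "of_nat (d div gcd d g) * of_nat (gcd d g) = (of_nat d :: complex)" by (simp flip: of_nat_mult)
        moreover have "of_nat (gcd d g) \<noteq> (0 :: complex)" using d by simp
        ultimately show ?thesis by (subst nonzero_eq_divide_eq)
      qed
      then show ?thesis by (simp add: power_divide)
    qed
    finally show "(\<Sum>\<^sub>\<infinity>y\<in>T g \<times> primitive_pairs N g. ?f (j (g, y)))
      = zeta_sum w * ((of_nat (gcd d g) / of_nat d) ^ w * primitive_sum w N g z)" .
  qed
  finally show ?thesis by (simp only: sum_distrib_left)
qed

text \<open>
  Invert the linear system that expresses the dilates of \<open>G = 2 \<zeta> E\<close> by the primitive sums.
\<close>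
lemma primitive_sum_eq_eisenstein_E_combination:
  assumes "squarefree N" "k > 1" "c dvd N" "z \<in> upper_half_plane"
  shows "primitive_sum (2 * k) N c z
    = (\<Sum>d | d dvd N. 2 * cusp_weight (2 * k) N c d * eisenstein_E k (of_nat d * z))"
proof -
  let ?w = "2 * k"
  have "N > 0" using assms(1) by (metis gr0I not_squarefree_0)
  have nz: "zeta_sum ?w \<noteq> 0" using assms(2) by (intro zeta_sum_nonzero) auto
  have E: "2 * eisenstein_E k (of_nat d * z) = (\<Sum>g | g dvd N. (of_nat (gcd d g) / of_nat d) ^ ?w * primitive_sum ?w N g z)"
    if d: "d dvd N" for d
  proof -
    have "d > 0" using d \<open>N > 0\<close> by (auto intro!: Nat.gr0I)
    then have "of_nat d * z \<in> upper_half_plane" using assms(4) by (simp add: upper_half_plane_def)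
    from lattice_sum_eq_eisenstein_E[OF assms(2) this]
    have "zeta_sum ?w * (2 * eisenstein_E k (of_nat d * z)) = lattice_sum ?w (of_nat d * z)" by simp
    also have "\<dots> = zeta_sum ?w * (\<Sum>g | g dvd N. (of_nat (gcd d g) / of_nat d) ^ ?w * primitive_sum ?w N g z)"
      using \<open>N > 0\<close> d assms(2,4) by (intro lattice_sum_scaled_eq_primitive_sums) auto
    finally show ?thesis using nz by simp
  qed
  have "(\<Sum>d | d dvd N. 2 * cusp_weight ?w N c d * eisenstein_E k (of_nat d * z))
     = (\<Sum>d | d dvd N. cusp_weight ?w N c d * (2 * eisenstein_E k (of_nat d * z)))"
    by (intro sum.cong) auto
  also have "\<dots> = (\<Sum>d | d dvd N. \<Sum>g | g dvd N. cusp_weight ?w N c d * (of_nat (gcd d g) / of_nat d) ^ ?w * primitive_sum ?w N g z)"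
    by (intro sum.cong refl) (simp add: E sum_distrib_left mult.assoc)
  also have "\<dots> = (\<Sum>g | g dvd N. (\<Sum>d | d dvd N. cusp_weight ?w N c d * (of_nat (gcd d g) / of_nat d) ^ ?w) * primitive_sum ?w N g z)"
    by (subst sum.swap) (simp add: sum_distrib_right)
  also have "\<dots> = (\<Sum>g | g dvd N. if c = g then primitive_sum ?w N g z else 0)"
    using assms(2) by (intro sum.cong refl, subst cusp_weight_inverse[OF assms(1) _ assms(3)]) auto
  also have "\<dots> = primitive_sum ?w N c z" using assms(3) \<open>N > 0\<close> by (simp add: sum.delta)
  finally show ?thesis by simp
qed

section \<open>The Eisenstein part of a modular form\<close>

text \<open>
  The upper triangular matrix \<open>(\<alpha>, \<beta>, 0, d / \<alpha>)\<close> turns the expansion of \<open>E\<close> into one of period \<open>N\<close> with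
  the same constant term 1; the power of \<open>\<alpha> / d\<close> is the automorphy factor.
\<close>
lemma eisenstein_E_scaled_expansion:
  assumes "k > 1" "N > 0" "d dvd N" "(a, b, c, e) \<in> SL2Z"
  shows "\<exists>x. has_fourier_expansion (real N) (slash (2 * k) (\<lambda>z. eisenstein_E k (of_nat d * z)) (a, b, c, e)) x
    \<and> x 0 = (of_nat (gcd d (nat \<bar>c\<bar>)) / of_nat d) ^ (2 * k)"
proof -
  define al where "al = gcd d (nat \<bar>c\<bar>)"
  define de where "de = d div al"
  have "d > 0" using assms(2,3) by (auto intro!: Nat.gr0I)
  have "al dvd d" unfolding al_def by (rule gcd_dvd1)
  then have d: "d = al * de" by (simp add: de_def)
  then have pos: "al > 0" "de > 0" using \<open>d > 0\<close> by (auto intro!: Nat.gr0I)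
  have "de dvd N" using d assms(3) by (metis dvd_trans dvd_triv_right)
  obtain be where be: "\<And>z. z \<in> upper_half_plane \<Longrightarrow>
      slash (2 * k) (\<lambda>z. eisenstein_E k (of_nat d * z)) (a, b, c, e) z
      = (of_nat al / of_nat d) ^ (2 * k) * eisenstein_E k ((of_nat al * z + of_int be) / of_nat de)"
    using slash_eisenstein_E_scaled[OF assms(1) \<open>d > 0\<close> assms(4)] unfolding al_def de_def by blast
  have "has_fourier_expansion 1 (eisenstein_E k) (eisenstein_E_coeff k)"
    using assms(1) by (intro eisenstein_E_fourier) simp
  then obtain x where x: "has_fourier_expansion (real N) (\<lambda>z. eisenstein_E k ((of_nat al * z + of_int be) / of_nat de)) x"
    and x0: "x 0 = 1"
    using pos \<open>de dvd N\<close> assms(2)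
    by (rule that[OF has_fourier_expansion_rescale]) (simp add: eisenstein_E_coeff_def)
  have "has_fourier_expansion (real N) (slash (2 * k) (\<lambda>z. eisenstein_E k (of_nat d * z)) (a, b, c, e))
      (\<lambda>n. (of_nat al / of_nat d) ^ (2 * k) * x n)"
    by (rule has_fourier_expansion_cong[THEN iffD2, OF _ has_fourier_expansion_cmult[OF x]]) (rule be)
  moreover have "(of_nat al / of_nat d) ^ (2 * k) * x 0 = (of_nat al / of_nat d) ^ (2 * k)"
    by (simp add: x0)
  ultimately show ?thesis unfolding al_def by blast
qed

lemma eisenstein_E_scaled_modular_form:
  assumes "k > 1" "N > 0" "d dvd N"
  shows "(\<lambda>z. eisenstein_E k (of_nat d * z)) \<in> modular_forms (2 * k) N"
proof -
  let ?g = "\<lambda>z. eisenstein_E k (of_nat d * z)"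
  have "d > 0" using assms(2,3) by (auto intro!: Nat.gr0I)
  have dz: "of_nat d * z \<in> upper_half_plane" if "z \<in> upper_half_plane" for z
    using that \<open>d > 0\<close> by (simp add: upper_half_plane_def)
  have "eisenstein_E k holomorphic_on upper_half_plane"
    using assms(1) by (intro has_fourier_expansion_imp_holomorphic[OF _ eisenstein_E_fourier]) auto
  then have "(eisenstein_E k \<circ> (\<lambda>z. of_nat d * z)) holomorphic_on upper_half_plane"
    by (intro holomorphic_on_compose_gen[of _ _ _ upper_half_plane] holomorphic_intros) (use dz in auto)
  then have "?g holomorphic_on upper_half_plane" by (simp add: o_def)
  moreover have "slash (2 * k) ?g A z = ?g z" if A0: "A \<in> Gamma0 N" and z: "z \<in> upper_half_plane" for A z
  proof -
    obtain a b c e where A: "A = (a, b, c, e)" by (metis prod_cases4)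
    have SL: "(a, b, c, e) \<in> SL2Z" and c: "int N dvd c" using A0 A by (auto simp: Gamma0_def)
    have "int d dvd c" using c assms(3) by (meson dvd_trans of_nat_dvd_iff)
    then have "d dvd nat \<bar>c\<bar>" by (simp add: nat_dvd_iff dvd_nat_abs_iff)
    then have gcd: "gcd d (nat \<bar>c\<bar>) = d" by (simp add: gcd_nat.absorb1)
    obtain be where "slash (2 * k) ?g (a, b, c, e) z
        = (of_nat d / of_nat d) ^ (2 * k) * eisenstein_E k ((of_nat d * z + of_int be) / of_nat (d div d))"
      using slash_eisenstein_E_scaled[OF assms(1) \<open>d > 0\<close> SL] z unfolding gcd by blast
    then show ?thesis using \<open>d > 0\<close> eisenstein_E_translate[OF assms(1) dz[OF z]] by (simp add: A)
  qed
  moreover have "\<exists>x. has_fourier_expansion (real N) (slash (2 * k) ?g A) x" if "A \<in> SL2Z" for A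
    using eisenstein_E_scaled_expansion[OF assms] that by (cases A) blast
  ultimately show ?thesis by (simp add: modular_forms_def)
qed

lemma coeff_at_cusp_eisenstein_E_scaled:
  assumes "k > 1" "N > 0" "d dvd N" "c dvd N"
  shows "coeff_at_cusp N (2 * k) c 0 (\<lambda>z. eisenstein_E k (of_nat d * z)) = (of_nat (gcd d c) / of_nat d) ^ (2 * k)"
proof -
  obtain x where x: "has_fourier_expansion (real N) (slash (2 * k) (\<lambda>z. eisenstein_E k (of_nat d * z)) (1, 0, int c, 1)) x"
    "x 0 = (of_nat (gcd d c) / of_nat d) ^ (2 * k)"
    using eisenstein_E_scaled_expansion[OF assms(1-3) unipotent_SL2Z(1)[of "int c"]] by auto
  show ?thesis
    using coeff_at_cusp_eq[OF eisenstein_E_scaled_modular_form[OF assms(1-3)] assms(4,2) x(1), of 0] x(2) by simp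
qed

lemma coeff_at_infinity_eisenstein_E_scaled:
  assumes "k > 1" "d > 0" "n > 0"
  shows "coeff_at_infinity n (\<lambda>z. eisenstein_E k (of_nat d * z))
    = - of_nat (4 * k) / of_real (bernoulli_number (2 * k)) * of_nat (divisor_sigma (2 * k - 1) (of_nat n / of_nat d))"
proof -
  have "has_fourier_expansion 1 (eisenstein_E k) (eisenstein_E_coeff k)"
    using assms(1) by (intro eisenstein_E_fourier) simp
  from has_fourier_expansion_rescale[OF this assms(2), of 1 1 0]
  have "has_fourier_expansion 1 (\<lambda>z. eisenstein_E k (of_nat d * z))
      (\<lambda>n. if d dvd n then eisenstein_E_coeff k (n div d) else 0)" by (simp cong: if_cong)
  then have *: "coeff_at_infinity n (\<lambda>z. eisenstein_E k (of_nat d * z))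
      = (if d dvd n then eisenstein_E_coeff k (n div d) else 0)"
    unfolding coeff_at_infinity_def by (subst fourier_coeff_eq) auto
  show ?thesis
  proof (cases "d dvd n")
    case True
    then obtain m where m: "n = d * m" by blast
    then have "m > 0" using assms(3) by (auto intro!: Nat.gr0I)
    have "(of_nat n / of_nat d :: rat) = of_nat m" using assms(2) by (simp add: m)
    then show ?thesis unfolding * using True m assms(2) \<open>m > 0\<close> by (simp add: eisenstein_E_coeff_def)
  next
    case False
    have "(of_nat n / of_nat d :: rat) \<noteq> of_nat m" for m
    proof
      assume "(of_nat n / of_nat d :: rat) = of_nat m"
      then have "(of_nat n :: rat) = of_nat (m * d)" using assms(2) by (simp add: nonzero_divide_eq_eq)
      then have "n = m * d" by (simp only: of_nat_eq_iff)
      with False show False by simp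
    qed
    then have "divisor_sigma (2 * k - 1) (of_nat n / of_nat d) = 0" by (simp add: divisor_sigma_def)
    with False show ?thesis unfolding * by simp
  qed
qed

lemma modular_forms_linear_combination:
  assumes "\<And>i. i \<in> I \<Longrightarrow> f i \<in> modular_forms w N"
  shows "(\<lambda>z. \<Sum>i\<in>I. u i * f i z) \<in> modular_forms w N"
proof -
  have "\<exists>a. has_fourier_expansion (real N) (slash w (\<lambda>z. \<Sum>i\<in>I. u i * f i z) A) a" if A: "A \<in> SL2Z" for A
  proof -
    have "\<forall>i\<in>I. \<exists>a. has_fourier_expansion (real N) (slash w (f i) A) a"
      using assms A unfolding modular_forms_def by blast
    then obtain a where "\<And>i. i \<in> I \<Longrightarrow> has_fourier_expansion (real N) (slash w (f i) A) (a i)"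
      by metis
    then have "has_fourier_expansion (real N) (\<lambda>z. \<Sum>i\<in>I. u i * slash w (f i) A z) (\<lambda>n. \<Sum>i\<in>I. u i * a i n)"
      by (intro has_fourier_expansion_sum has_fourier_expansion_cmult)
    then show ?thesis unfolding slash_sum_scaled by blast
  qed
  moreover have "(\<lambda>z. \<Sum>i\<in>I. u i * f i z) holomorphic_on upper_half_plane"
    using assms by (intro holomorphic_intros) (auto simp: modular_forms_def)
  moreover have "slash w (\<lambda>z. \<Sum>i\<in>I. u i * f i z) A z = (\<Sum>i\<in>I. u i * f i z)"
    if "A \<in> Gamma0 N" "z \<in> upper_half_plane" for A z
    unfolding slash_sum_scaled using assms that by (intro sum.cong) (auto simp: modular_forms_def)
  ultimately show ?thesis by (simp add: modular_forms_def)
qed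

lemma coeff_at_cusp_linear_combination:
  assumes "\<And>i. i \<in> I \<Longrightarrow> f i \<in> modular_forms w N" "c dvd N" "N > 0"
  shows "coeff_at_cusp N w c n (\<lambda>z. \<Sum>i\<in>I. u i * f i z) = (\<Sum>i\<in>I. u i * coeff_at_cusp N w c n (f i))"
proof -
  have "\<forall>i\<in>I. \<exists>a. has_fourier_expansion (real N) (slash w (f i) (1, 0, int c, 1)) a"
    using assms(1) unipotent_SL2Z unfolding modular_forms_def by blast
  then obtain a where a: "\<And>i. i \<in> I \<Longrightarrow> has_fourier_expansion (real N) (slash w (f i) (1, 0, int c, 1)) (a i)"
    by metis
  then have "has_fourier_expansion (real N) (\<lambda>z. \<Sum>i\<in>I. u i * slash w (f i) (1, 0, int c, 1) z) (\<lambda>n. \<Sum>i\<in>I. u i * a i n)"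
    by (intro has_fourier_expansion_sum has_fourier_expansion_cmult)
  then have "has_fourier_expansion (real N) (slash w (\<lambda>z. \<Sum>i\<in>I. u i * f i z) (1, 0, int c, 1)) (\<lambda>n. \<Sum>i\<in>I. u i * a i n)"
    unfolding slash_sum_scaled[abs_def] .
  from coeff_at_cusp_eq[OF modular_forms_linear_combination assms(2,3) this] assms(1)
  have "coeff_at_cusp N w c n (\<lambda>z. \<Sum>i\<in>I. u i * f i z) = (\<Sum>i\<in>I. u i * a i (c * n))" by blast
  then show ?thesis using coeff_at_cusp_eq[OF assms(1) assms(2,3) a] by simp
qed

lemma coeff_at_infinity_linear_combination:
  assumes "\<And>i. i \<in> I \<Longrightarrow> f i \<in> modular_forms w N" "N > 0"
  shows "coeff_at_infinity n (\<lambda>z. \<Sum>i\<in>I. u i * f i z) = (\<Sum>i\<in>I. u i * coeff_at_infinity n (f i))"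
proof -
  have "has_fourier_expansion 1 (\<lambda>z. \<Sum>i\<in>I. u i * f i z) (\<lambda>n. \<Sum>i\<in>I. u i * coeff_at_infinity n (f i))"
    using assms by (intro has_fourier_expansion_sum has_fourier_expansion_cmult fourier_expansion_at_infinity)
  then show ?thesis unfolding coeff_at_infinity_def using fourier_coeff_eq[of 1] by simp
qed

lemma coeff_at_cusp_cong:
  assumes "\<And>z. z \<in> upper_half_plane \<Longrightarrow> f z = g z"
  shows "coeff_at_cusp N w c n f = coeff_at_cusp N w c n g"
proof -
  have "f (z / (of_nat c * z + 1)) = g (z / (of_nat c * z + 1))" if "z \<in> upper_half_plane" for z
    using moebius_upper_half_plane[OF unipotent_SL2Z(1) that, of "int c"] assms by simp
  then show ?thesis unfolding coeff_at_cusp_def by (subst fourier_coeff_cong) auto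
qed

lemma coeff_at_infinity_cong:
  assumes "\<And>z. z \<in> upper_half_plane \<Longrightarrow> f z = g z"
  shows "coeff_at_infinity n f = coeff_at_infinity n g"
  unfolding coeff_at_infinity_def using fourier_coeff_cong[OF assms] by simp

lemma eisenstein_part_coeff_eq:
  "eisenstein_part_coeff N k f d = (\<Sum>c | c dvd N. cusp_weight (2 * k) N c d * coeff_at_cusp N (2 * k) c 0 f)"
  unfolding eisenstein_part_coeff_def cusp_weight_def ..

context
  fixes N k :: nat
  assumes N: "squarefree N" and k: "k > 1"
begin

lemma level_pos: "N > 0"
  using N by (metis gr0I not_squarefree_0)

lemma eisenstein_combination_modular_form:
  "(\<lambda>z. \<Sum>d | d dvd N. v d * eisenstein_E k (of_nat d * z)) \<in> modular_forms (2 * k) N"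
  using eisenstein_E_scaled_modular_form[OF k level_pos] by (intro modular_forms_linear_combination) auto

lemma coeff_at_cusp_eisenstein_combination:
  assumes "c dvd N"
  shows "coeff_at_cusp N (2 * k) c 0 (\<lambda>z. \<Sum>d | d dvd N. v d * eisenstein_E k (of_nat d * z))
    = (\<Sum>d | d dvd N. v d * (of_nat (gcd d c) / of_nat d) ^ (2 * k))"
  using eisenstein_E_scaled_modular_form[OF k level_pos] coeff_at_cusp_eisenstein_E_scaled[OF k level_pos _ assms] assms level_pos
  by (subst coeff_at_cusp_linear_combination) auto

lemma coeff_at_infinity_eisenstein_combination:
  assumes "n > 0"
  shows "coeff_at_infinity n (\<lambda>z. \<Sum>d | d dvd N. v d * eisenstein_E k (of_nat d * z))
    = - of_nat (4 * k) / of_real (bernoulli_number (2 * k)) *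
        (\<Sum>d | d dvd N. v d * of_nat (divisor_sigma (2 * k - 1) (of_nat n / of_nat d)))"
proof -
  have "coeff_at_infinity n (\<lambda>z. \<Sum>d | d dvd N. v d * eisenstein_E k (of_nat d * z))
    = (\<Sum>d | d dvd N. v d * coeff_at_infinity n (\<lambda>z. eisenstein_E k (of_nat d * z)))"
    using eisenstein_E_scaled_modular_form[OF k level_pos] level_pos
    by (intro coeff_at_infinity_linear_combination) auto
  also have "\<dots> = (\<Sum>d | d dvd N. - of_nat (4 * k) / of_real (bernoulli_number (2 * k)) *
      (v d * of_nat (divisor_sigma (2 * k - 1) (of_nat n / of_nat d))))"
  proof (rule sum.cong[OF refl])
    fix d assume "d \<in> {d. d dvd N}"
    then have "d > 0" using level_pos by (auto intro!: Nat.gr0I)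
    show "v d * coeff_at_infinity n (\<lambda>z. eisenstein_E k (of_nat d * z))
        = - of_nat (4 * k) / of_real (bernoulli_number (2 * k)) *
          (v d * of_nat (divisor_sigma (2 * k - 1) (of_nat n / of_nat d)))"
      unfolding coeff_at_infinity_eisenstein_E_scaled[OF k \<open>d > 0\<close> assms] by (simp only: mult_ac)
  qed
  finally show ?thesis by (simp only: sum_distrib_left)
qed

text \<open>
  The sum on the left is the constant term of the Eisenstein part of \<open>f\<close> at the cusp \<open>1/c\<close>: the
  coefficients \<open>eisenstein_part_coeff\<close> are designed to make it agree with that of \<open>f\<close>.
\<close>
lemma eisenstein_part_interpolates_cusp_constants:
  assumes "c dvd N"
  shows "(\<Sum>d | d dvd N. eisenstein_part_coeff N k f d * (of_nat (gcd d c) / of_nat d) ^ (2 * k))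
    = coeff_at_cusp N (2 * k) c 0 f"
proof -
  let ?X = "cusp_weight (2 * k) N" and ?a = "\<lambda>c. coeff_at_cusp N (2 * k) c 0 f"
  have "(\<Sum>d | d dvd N. eisenstein_part_coeff N k f d * (of_nat (gcd d c) / of_nat d) ^ (2 * k))
    = (\<Sum>d | d dvd N. \<Sum>b | b dvd N. ?X b d * (of_nat (gcd d c) / of_nat d) ^ (2 * k) * ?a b)"
    unfolding eisenstein_part_coeff_eq sum_distrib_right by (intro sum.cong refl) (simp only: mult_ac)
  also have "\<dots> = (\<Sum>b | b dvd N. (\<Sum>d | d dvd N. ?X b d * (of_nat (gcd d c) / of_nat d) ^ (2 * k)) * ?a b)"
    by (subst sum.swap) (simp add: sum_distrib_right)
  also have "\<dots> = (\<Sum>b | b dvd N. if b = c then ?a b else 0)"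
    using k assms by (intro sum.cong refl, subst cusp_weight_inverse[OF N]) auto
  also have "\<dots> = ?a c" using assms level_pos by (simp add: sum.delta')
  finally show ?thesis .
qed

text \<open>
  Equivalent cusps have the same Eisenstein series, which is a combination of the dilates of \<open>E\<close>.
  Up to a factor 2, \<open>v c\<close> collects the coefficients in \<open>f\<close> of all cusps whose denominator has the
  gcd \<open>c\<close> with \<open>N\<close>.
\<close>
lemma eisenstein_form_eq_eisenstein_combination:
  assumes "f \<in> eisenstein_forms (2 * k) N"
  obtains v where "\<And>z. z \<in> upper_half_plane \<Longrightarrow>
      f z = (\<Sum>d | d dvd N. (\<Sum>c | c dvd N. cusp_weight (2 * k) N c d * v c) * eisenstein_E k (of_nat d * z))"
proof -
  obtain S u where S: "finite S" "\<forall>(a, c)\<in>S. coprime a c"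
    and f: "\<And>z. z \<in> upper_half_plane \<Longrightarrow> f z = (\<Sum>s\<in>S. u s * cusp_eisenstein_series (2 * k) N s z)"
    using assms unfolding eisenstein_forms_def by blast
  define g where "g s = nat (gcd (snd s) (int N))" for s :: "int \<times> int"
  have g: "g s dvd N" for s by (simp add: g_def nat_dvd_iff)
  define v where "v c = (\<Sum>s | s \<in> S \<and> g s = c. 2 * u s)" for c
  have "f z = (\<Sum>d | d dvd N. (\<Sum>c | c dvd N. cusp_weight (2 * k) N c d * v c) * eisenstein_E k (of_nat d * z))"
    if z: "z \<in> upper_half_plane" for z
  proof -
    let ?P = "\<lambda>c. \<Sum>d | d dvd N. cusp_weight (2 * k) N c d * eisenstein_E k (of_nat d * z)"
    have "f z = (\<Sum>s\<in>S. 2 * u s * ?P (g s))"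
      unfolding f[OF z]
    proof (rule sum.cong[OF refl])
      fix s assume "s \<in> S"
      then obtain a c where s: "s = (a, c)" "coprime a c" using S(2) by (cases s) auto
      have "cusp_eisenstein_series (2 * k) N s z = primitive_sum (2 * k) N (g s) z"
        using cusp_eisenstein_series_eq_primitive_sum[OF N s(2)] by (simp add: s(1) g_def)
      also have "\<dots> = 2 * ?P (g s)"
        using primitive_sum_eq_eisenstein_E_combination[OF N k g z] by (simp add: sum_distrib_left mult.assoc)
      finally show "u s * cusp_eisenstein_series (2 * k) N s z = 2 * u s * ?P (g s)" by simp
    qed
    also have "\<dots> = (\<Sum>c | c dvd N. \<Sum>s | s \<in> S \<and> g s = c. 2 * u s * ?P (g s))"
      using S(1) level_pos g by (intro sum.group[symmetric]) auto
    also have "\<dots> = (\<Sum>c | c dvd N. v c * ?P c)"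
      by (intro sum.cong refl) (simp add: v_def sum_distrib_right)
    also have "\<dots> = (\<Sum>c | c dvd N. \<Sum>d | d dvd N. cusp_weight (2 * k) N c d * v c * eisenstein_E k (of_nat d * z))"
      by (simp add: sum_distrib_left mult_ac)
    also have "\<dots> = (\<Sum>d | d dvd N. (\<Sum>c | c dvd N. cusp_weight (2 * k) N c d * v c) * eisenstein_E k (of_nat d * z))"
      by (subst sum.swap) (simp add: sum_distrib_right)
    finally show ?thesis .
  qed
  then show thesis using that by blast
qed

text \<open>
  Take constant terms at the cusp \<open>1/c\<close> in the representation of \<open>f\<close> by the dilates of \<open>E\<close>. As the weights
  invert the matrix of constant terms, this recovers the coefficients of the Eisenstein series of the
  cusps, and hence those of the dilates.
\<close>
lemma eisenstein_form_eq_eisenstein_part: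
  assumes "f \<in> eisenstein_forms (2 * k) N" "z \<in> upper_half_plane"
  shows "f z = (\<Sum>d | d dvd N. eisenstein_part_coeff N k f d * eisenstein_E k (of_nat d * z))"
proof -
  let ?X = "cusp_weight (2 * k) N"
  obtain v where v: "\<And>z. z \<in> upper_half_plane \<Longrightarrow>
      f z = (\<Sum>d | d dvd N. (\<Sum>c | c dvd N. ?X c d * v c) * eisenstein_E k (of_nat d * z))"
    using eisenstein_form_eq_eisenstein_combination[OF assms(1)] by blast
  have "coeff_at_cusp N (2 * k) c 0 f = v c" if c: "c dvd N" for c
  proof -
    have "coeff_at_cusp N (2 * k) c 0 f
      = (\<Sum>d | d dvd N. (\<Sum>b | b dvd N. ?X b d * v b) * (of_nat (gcd d c) / of_nat d) ^ (2 * k))"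
      using coeff_at_cusp_cong[OF v] coeff_at_cusp_eisenstein_combination[OF c] by simp
    also have "\<dots> = (\<Sum>d | d dvd N. \<Sum>b | b dvd N. ?X b d * (of_nat (gcd d c) / of_nat d) ^ (2 * k) * v b)"
      unfolding sum_distrib_right by (intro sum.cong refl) (simp only: mult_ac)
    also have "\<dots> = (\<Sum>b | b dvd N. (\<Sum>d | d dvd N. ?X b d * (of_nat (gcd d c) / of_nat d) ^ (2 * k)) * v b)"
      by (subst sum.swap) (simp add: sum_distrib_right)
    also have "\<dots> = (\<Sum>b | b dvd N. if b = c then v b else 0)"
      using k c by (intro sum.cong refl, subst cusp_weight_inverse[OF N]) auto
    also have "\<dots> = v c" using c level_pos by (simp add: sum.delta')
    finally show ?thesis .
  qed
  then show ?thesis using v[OF assms(2)] by (simp add: eisenstein_part_coeff_eq)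
qed

end


theorem theorem1p1:
  fixes N k :: nat and f :: "complex \<Rightarrow> complex"
  assumes "squarefree N" and "k > 1" and "f \<in> modular_forms (2 * k) N"
  shows "(\<exists>C \<in> cusp_forms (2 * k) N.
            (\<forall>z\<in>upper_half_plane.
               f z = (\<Sum>d | d dvd N. eisenstein_part_coeff N k f d * eisenstein_E k (of_nat d * z)) + C z)
          \<and> (\<forall>n>0. coeff_at_infinity n f =
               - of_nat (4 * k) / of_real (bernoulli_number (2 * k)) *
                 (\<Sum>d | d dvd N. eisenstein_part_coeff N k f d
                    * of_nat (divisor_sigma (2 * k - 1) (of_nat n / of_nat d)))
               + coeff_at_infinity n C))
       \<and> (f \<in> eisenstein_forms (2 * k) N \<longrightarrow>
            (\<forall>z\<in>upper_half_plane.
               f z = (\<Sum>d | d dvd N. eisenstein_part_coeff N k f d * eisenstein_E k (of_nat d * z)))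
          \<and> (\<forall>n>0. coeff_at_infinity n f =
               - of_nat (4 * k) / of_real (bernoulli_number (2 * k)) *
                 (\<Sum>d | d dvd N. eisenstein_part_coeff N k f d
                    * of_nat (divisor_sigma (2 * k - 1) (of_nat n / of_nat d)))))"
proof (intro conjI impI)
  define F where "F z = (\<Sum>d | d dvd N. eisenstein_part_coeff N k f d * eisenstein_E k (of_nat d * z))" for z
  define C where "C z = f z - F z" for z
  \<comment> \<open>The difference \<open>f - F\<close> is presented as a linear combination indexed by the booleans.\<close>
  define u where "u = (\<lambda>b. if b then 1 else - 1 :: complex)"
  define h where "h = (\<lambda>b. if b then f else F)"
  have Npos: "N > 0" using level_pos[OF assms(1,2)] .
  have C: "C = (\<lambda>z. \<Sum>b\<in>UNIV. u b * h b z)" by (simp add: C_def UNIV_bool u_def h_def fun_eq_iff)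
  have F: "F \<in> modular_forms (2 * k) N"
    unfolding F_def[abs_def] by (rule eisenstein_combination_modular_form[OF assms(1,2)])
  then have h: "h b \<in> modular_forms (2 * k) N" for b using assms(3) by (simp add: h_def)
  have Fn: "coeff_at_infinity n F = - of_nat (4 * k) / of_real (bernoulli_number (2 * k)) *
      (\<Sum>d | d dvd N. eisenstein_part_coeff N k f d * of_nat (divisor_sigma (2 * k - 1) (of_nat n / of_nat d)))"
    if "n > 0" for n
    unfolding F_def[abs_def] by (rule coeff_at_infinity_eisenstein_combination[OF assms(1,2) that])
  have "C \<in> cusp_forms (2 * k) N"
  proof (rule cusp_formI[OF assms(1)])
    show "C \<in> modular_forms (2 * k) N"
      unfolding C by (rule modular_forms_linear_combination) (rule h)
    fix c assume c: "c dvd N"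
    have "coeff_at_cusp N (2 * k) c 0 F = coeff_at_cusp N (2 * k) c 0 f"
      unfolding F_def[abs_def] coeff_at_cusp_eisenstein_combination[OF assms(1,2) c]
      by (rule eisenstein_part_interpolates_cusp_constants[OF assms(1,2) c])
    then show "coeff_at_cusp N (2 * k) c 0 C = 0"
      unfolding C coeff_at_cusp_linear_combination[OF h c Npos] by (simp add: UNIV_bool u_def h_def)
  qed
  moreover have "coeff_at_infinity n f = coeff_at_infinity n F + coeff_at_infinity n C" for n
    unfolding C coeff_at_infinity_linear_combination[OF h Npos] by (simp add: UNIV_bool u_def h_def)
  ultimately show "\<exists>C \<in> cusp_forms (2 * k) N.
            (\<forall>z\<in>upper_half_plane.
               f z = (\<Sum>d | d dvd N. eisenstein_part_coeff N k f d * eisenstein_E k (of_nat d * z)) + C z)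
          \<and> (\<forall>n>0. coeff_at_infinity n f =
               - of_nat (4 * k) / of_real (bernoulli_number (2 * k)) *
                 (\<Sum>d | d dvd N. eisenstein_part_coeff N k f d
                    * of_nat (divisor_sigma (2 * k - 1) (of_nat n / of_nat d)))
               + coeff_at_infinity n C)"
    using Fn by (intro bexI[of _ C] conjI ballI allI impI) (simp add: C_def F_def, simp only:)
  assume E: "f \<in> eisenstein_forms (2 * k) N"
  then have fF: "f z = F z" if "z \<in> upper_half_plane" for z
    unfolding F_def by (rule eisenstein_form_eq_eisenstein_part[OF assms(1,2)]) (rule that)
  then show "\<forall>z\<in>upper_half_plane.
      f z = (\<Sum>d | d dvd N. eisenstein_part_coeff N k f d * eisenstein_E k (of_nat d * z))"
    by (simp add: F_def)
  show "\<forall>n>0. coeff_at_infinity n f =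
               - of_nat (4 * k) / of_real (bernoulli_number (2 * k)) *
                 (\<Sum>d | d dvd N. eisenstein_part_coeff N k f d
                    * of_nat (divisor_sigma (2 * k - 1) (of_nat n / of_nat d)))"
    using coeff_at_infinity_cong[OF fF] Fn by simp
qed

end
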